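(* Let \[ \mathcal{F}=\Big\{\tfrac12\sum_{i=1}^{\infty}\left(-\tfrac32\right)^{-i}\varphi(d_{-i})\;\Big|\;d_{-i}\in\{0,1,2\}\Big\}\subset\mathbb{K}. \] Then the collection $\mathcal{C}=\{\mathcal{F}+\varphi(z)\mid z\in\mathbb{Z}[\tfrac12]\}$ forms a tiling of $\mathbb{K}$, that is: (1) $\bigcup_{z\in\mathbb{Z}[\frac12]}(\mathcal{F}+\varphi(z))=\mathbb{K}$, and (2) $\mu$-almost every point of $\mathbb{K}$ is contained in exactly one element of $\mathcal{C}$.
   Context: $\mathbb{Z}[\tfrac12]=\{a2^{-\ell}\mid a\in\mathbb{Z},\ \ell\in\mathbb{N}\}$. $\mathbb{Q}_2$ is the field of $2$-adic numbers with $2$-adic absolute value $|\cdot|_2$, and $\mathbb{Z}_2$ its ring of integers. $\mathbb{K}=\mathbb{R}\times\mathbb{Q}_2$ with componentwise addition, multiplication by a rational $\alpha$ given by $\alpha(x_1,x_2)=(\alpha x_1,\alpha x_2)$, and metric $\mathbf{d}((x_1,x_2),(y_1,y_2))=\max\{|x_1-y_1|,|x_2-y_2|_2\}$. $\varphi:\mathbb{Q}\to\mathbb{K}$ is $\varphi(z)=(z,z)$. The measure $\mu=\mu_\infty\times\mu_2$ on $\mathbb{K}$ is the product of Lebesgue measure on $\mathbb{R}$ and the Haar measure $\mu_2$ on $\mathbb{Q}_2$ normalized by $\mu_2(2^\ell\mathbb{Z}_2)=2^{-\ell}$. *)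

theory Defs
  imports "HOL-Analysis.Analysis"
begin

section \<open>The 2-adic absolute value on the rationals\<close>

definition abs2 :: "rat \<Rightarrow> real" where
  "abs2 q = (if q = 0 then 0
     else 2 powi (int (multiplicity 2 (snd (quotient_of q))) - int (multiplicity 2 (fst (quotient_of q)))))"

lemma abs2_frac:
  assumes "a \<noteq> 0" "b \<noteq> 0"
  shows "abs2 (of_int a / of_int b) = 2 powi (int (multiplicity 2 b) - int (multiplicity 2 a))"
proof -
  obtain n d where nd: "quotient_of (of_int a / of_int b) = (n, d)"
    by (cases "quotient_of (of_int a / of_int b)") auto
  have d: "d > 0" and eq: "(of_int a / of_int b :: rat) = of_int n / of_int d"
    using quotient_of_denom_pos[OF nd] quotient_of_div[OF nd] by auto
  then have "(of_int (a * d) :: rat) = of_int (n * b)"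
    using assms d by (simp add: field_simps)
  then have e: "a * d = n * b" by (simp only: of_int_eq_iff)
  then have n: "n \<noteq> 0" using assms d by auto
  have "prime_elem (2::int)" by simp
  then have "multiplicity 2 a + multiplicity 2 d = multiplicity 2 n + multiplicity 2 b"
    using prime_elem_multiplicity_mult_distrib[of "2::int" a d]
      prime_elem_multiplicity_mult_distrib[of "2::int" n b] e assms d n by simp
  then have "int (multiplicity 2 d) - int (multiplicity 2 n) = int (multiplicity 2 b) - int (multiplicity 2 a)"
    by linarith
  then show ?thesis using assms by (simp add: abs2_def nd)
qed

lemma rat_int_frac:
  fixes q :: rat
  obtains a b :: int where "q = of_int a / of_int b" "b > 0"
proof -
  obtain a b where "quotient_of q = (a, b)" by (cases "quotient_of q")
  then show ?thesis using that quotient_of_denom_pos quotient_of_div by blast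
qed

lemma abs2_0 [simp]: "abs2 0 = 0"
  by (simp add: abs2_def)

lemma abs2_nonneg [simp]: "abs2 q \<ge> 0"
  by (simp add: abs2_def)

lemma abs2_eq_0_iff [simp]: "abs2 q = 0 \<longleftrightarrow> q = 0"
  by (simp add: abs2_def)

lemma abs2_1 [simp]: "abs2 1 = 1"
  using abs2_frac[of 1 1] by simp

lemma abs2_2: "abs2 2 = 1 / 2"
  using abs2_frac[of 2 1] by (simp add: multiplicity_prime power_int_minus)

lemma abs2_mult: "abs2 (p * q) = abs2 p * abs2 q"
proof (cases "p = 0 \<or> q = 0")
  case False
  obtain a b c d :: int where p: "p = of_int a / of_int b" "b > 0" and q: "q = of_int c / of_int d" "d > 0"
    using rat_int_frac by metis
  with False have ac: "a \<noteq> 0" "c \<noteq> 0" by auto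
  have "p * q = of_int (a * c) / of_int (b * d)" using p q by simp
  then have "abs2 (p * q) = 2 powi (int (multiplicity 2 (b * d)) - int (multiplicity 2 (a * c)))"
    using abs2_frac[of "a * c" "b * d"] ac p q by simp
  also have "\<dots> = 2 powi ((int (multiplicity 2 b) - int (multiplicity 2 a)) + (int (multiplicity 2 d) - int (multiplicity 2 c)))"
    using ac p q by (simp add: prime_elem_multiplicity_mult_distrib algebra_simps)
  also have "\<dots> = abs2 p * abs2 q"
    unfolding p q using ac p q by (subst power_int_add) (simp_all add: abs2_frac)
  finally show ?thesis .
qed auto

lemma abs2_minus [simp]: "abs2 (- q) = abs2 q"
proof -
  have "abs2 (-1) * abs2 (-1) = 1" using abs2_mult[of "-1" "-1"] by simp
  then have "abs2 (-1) = 1"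
    using abs2_nonneg[of "-1"] square_eq_1_iff[of "abs2 (-1)"] by linarith
  then show ?thesis using abs2_mult[of "-1" q] by simp
qed

lemma abs2_diff_commute: "abs2 (p - q) = abs2 (q - p)"
  using abs2_minus[of "p - q"] by simp

lemma abs2_inverse: "abs2 (inverse q) = inverse (abs2 q)"
proof (cases "q = 0")
  case False
  then have "abs2 (inverse q) * abs2 q = 1" by (simp flip: abs2_mult)
  then show ?thesis by (metis inverse_unique mult.commute)
qed auto

lemma abs2_add: "abs2 (p + q) \<le> max (abs2 p) (abs2 q)"
proof (cases "p = 0 \<or> q = 0 \<or> p + q = 0")
  case False
  obtain a b c d :: int where p: "p = of_int a / of_int b" "b > 0" and q: "q = of_int c / of_int d" "d > 0"
    using rat_int_frac by metis
  define u v w where "u = a * d" "v = c * b" "w = b * d"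
  have P: "p = of_int u / of_int w" and Q: "q = of_int v / of_int w" and w: "w \<noteq> 0"
    using p q by (auto simp: u_v_w_def)
  have PQ: "p + q = of_int (u + v) / of_int w" unfolding P Q by (simp add: add_divide_distrib)
  have nz: "u \<noteq> 0" "v \<noteq> 0" "u + v \<noteq> 0" using False P Q PQ by auto
  define m where "m = min (multiplicity 2 u) (multiplicity 2 v)"
  have "2 ^ m dvd u + v" unfolding m_def by (intro dvd_add multiplicity_dvd') auto
  then have m: "m \<le> multiplicity 2 (u + v)" using nz by (intro multiplicity_geI) auto
  have "abs2 (p + q) \<le> 2 powi (int (multiplicity 2 w) - int m)"
    unfolding PQ using nz w m by (subst abs2_frac) (auto intro!: power_int_increasing)
  also have "\<dots> \<le> max (abs2 p) (abs2 q)"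
    unfolding P Q using nz w by (auto simp: abs2_frac m_def min_def)
  finally show ?thesis .
qed (auto simp: le_max_iff_disj)

lemma abs2_diff: "abs2 (p - q) \<le> max (abs2 p) (abs2 q)"
  using abs2_add[of p "- q"] by simp

lemma abs2_triangle: "abs2 (p + q) \<le> abs2 p + abs2 q"
  using abs2_add[of p q] abs2_nonneg[of p] abs2_nonneg[of q] by linarith

lemma abs2_abs_diff: "\<bar>abs2 p - abs2 q\<bar> \<le> abs2 (p - q)"
  using abs2_triangle[of "p - q" q] abs2_triangle[of "q - p" p] abs2_diff_commute[of p q] by auto


section \<open>The field of 2-adic numbers as the completion of the rationals\<close>

definition vanishes2 :: "(nat \<Rightarrow> rat) \<Rightarrow> bool" where
  "vanishes2 X \<longleftrightarrow> (\<lambda>n. abs2 (X n)) \<longlonglongrightarrow> 0"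

definition cauchy2 :: "(nat \<Rightarrow> rat) \<Rightarrow> bool" where
  "cauchy2 X \<longleftrightarrow> (\<forall>e>0. \<exists>k. \<forall>m\<ge>k. \<forall>n\<ge>k. abs2 (X m - X n) < e)"

lemma vanishes2_iff: "vanishes2 X \<longleftrightarrow> (\<forall>e>0. \<exists>k. \<forall>n\<ge>k. abs2 (X n) < e)"
  by (simp add: vanishes2_def LIMSEQ_iff)

lemma vanishes2_minus: "vanishes2 X \<Longrightarrow> vanishes2 (\<lambda>n. - X n)"
  by (simp add: vanishes2_def)

lemma vanishes2_le:
  assumes "vanishes2 X" "vanishes2 Y" "\<And>n. abs2 (Z n) \<le> abs2 (X n) + abs2 (Y n)"
  shows "vanishes2 Z"
  unfolding vanishes2_def
proof (rule Lim_null_comparison)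
  show "(\<lambda>n. abs2 (X n) + abs2 (Y n)) \<longlonglongrightarrow> 0"
    using tendsto_add[of "\<lambda>n. abs2 (X n)" 0 _ "\<lambda>n. abs2 (Y n)" 0] assms by (simp add: vanishes2_def)
  show "\<forall>\<^sub>F n in sequentially. norm (abs2 (Z n)) \<le> abs2 (X n) + abs2 (Y n)"
    using assms(3) by simp
qed

lemma vanishes2_add: "vanishes2 X \<Longrightarrow> vanishes2 Y \<Longrightarrow> vanishes2 (\<lambda>n. X n + Y n)"
  by (rule vanishes2_le[of X Y]) (auto intro: abs2_triangle)

lemma vanishes2_diff: "vanishes2 X \<Longrightarrow> vanishes2 Y \<Longrightarrow> vanishes2 (\<lambda>n. X n - Y n)"
  using vanishes2_add[OF _ vanishes2_minus, of X Y] by simp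

lemma cauchy2_const [simp]: "cauchy2 (\<lambda>n. c)"
  by (simp add: cauchy2_def)

lemma cauchy2_D:
  assumes "cauchy2 X" "0 < e"
  obtains k where "\<And>m n. m \<ge> k \<Longrightarrow> n \<ge> k \<Longrightarrow> abs2 (X m - X n) < e"
proof -
  have "\<exists>k. \<forall>m\<ge>k. \<forall>n\<ge>k. abs2 (X m - X n) < e" using assms unfolding cauchy2_def by blast
  then show ?thesis using that by blast
qed

lemma cauchy2_add:
  assumes "cauchy2 X" "cauchy2 Y" shows "cauchy2 (\<lambda>n. X n + Y n)"
  unfolding cauchy2_def
proof (intro allI impI)
  fix e :: real assume e: "0 < e"
  obtain i where i: "\<And>m n. m \<ge> i \<Longrightarrow> n \<ge> i \<Longrightarrow> abs2 (X m - X n) < e" using cauchy2_D[OF assms(1) e] by blast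
  obtain j where j: "\<And>m n. m \<ge> j \<Longrightarrow> n \<ge> j \<Longrightarrow> abs2 (Y m - Y n) < e" using cauchy2_D[OF assms(2) e] by blast
  show "\<exists>k. \<forall>m\<ge>k. \<forall>n\<ge>k. abs2 (X m + Y m - (X n + Y n)) < e"
  proof (intro exI[of _ "max i j"] allI impI)
    fix m n assume "max i j \<le> m" "max i j \<le> n"
    then have "max (abs2 (X m - X n)) (abs2 (Y m - Y n)) < e" using i j by simp
    moreover have "X m + Y m - (X n + Y n) = (X m - X n) + (Y m - Y n)" by simp
    ultimately show "abs2 (X m + Y m - (X n + Y n)) < e" using abs2_add order_le_less_trans by metis
  qed
qed

lemma cauchy2_minus: "cauchy2 X \<Longrightarrow> cauchy2 (\<lambda>n. - X n)"
  unfolding cauchy2_def by (metis abs2_minus minus_diff_minus)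

lemma cauchy2_diff: "cauchy2 X \<Longrightarrow> cauchy2 Y \<Longrightarrow> cauchy2 (\<lambda>n. X n - Y n)"
  using cauchy2_add[OF _ cauchy2_minus, of X Y] by simp

lemma cauchy2_Cauchy_abs2: "cauchy2 X \<Longrightarrow> Cauchy (\<lambda>n. abs2 (X n))"
  unfolding cauchy2_def Cauchy_def dist_real_def by (meson abs2_abs_diff order_le_less_trans)

lemma cauchy2_convergent_abs2: "cauchy2 X \<Longrightarrow> convergent (\<lambda>n. abs2 (X n))"
  by (rule Cauchy_convergent[OF cauchy2_Cauchy_abs2])

lemma cauchy2_bounded:
  assumes "cauchy2 X" obtains b where "b > 0" "\<And>n. abs2 (X n) \<le> b"
proof -
  have "Bseq (\<lambda>n. abs2 (X n))" using assms by (intro Cauchy_Bseq cauchy2_Cauchy_abs2)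
  then show ?thesis using that by (auto simp: Bseq_def)
qed

lemma cauchy2_mult:
  assumes "cauchy2 X" "cauchy2 Y" shows "cauchy2 (\<lambda>n. X n * Y n)"
  unfolding cauchy2_def
proof (intro allI impI)
  fix e :: real assume e: "0 < e"
  obtain a where a: "a > 0" "\<And>n. abs2 (X n) \<le> a" using cauchy2_bounded assms(1) by blast
  obtain b where b: "b > 0" "\<And>n. abs2 (Y n) \<le> b" using cauchy2_bounded assms(2) by blast
  obtain i where i: "\<And>m n. m \<ge> i \<Longrightarrow> n \<ge> i \<Longrightarrow> abs2 (X m - X n) < e / b"
    using cauchy2_D[OF assms(1), of "e / b"] e b by auto
  obtain j where j: "\<And>m n. m \<ge> j \<Longrightarrow> n \<ge> j \<Longrightarrow> abs2 (Y m - Y n) < e / a"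
    using cauchy2_D[OF assms(2), of "e / a"] e a by auto
  show "\<exists>k. \<forall>m\<ge>k. \<forall>n\<ge>k. abs2 (X m * Y m - X n * Y n) < e"
  proof (intro exI[of _ "max i j"] allI impI)
    fix m n assume mn: "max i j \<le> m" "max i j \<le> n"
    have "abs2 (X m) * abs2 (Y m - Y n) \<le> a * abs2 (Y m - Y n)" using a by (intro mult_right_mono) auto
    also have "\<dots> < e" using j[of m n] mn a by (simp add: field_simps)
    finally have 1: "abs2 (X m * (Y m - Y n)) < e" by (simp add: abs2_mult)
    have "abs2 (X m - X n) * abs2 (Y n) \<le> abs2 (X m - X n) * b" using b by (intro mult_left_mono) auto
    also have "\<dots> < e" using i[of m n] mn b by (simp add: field_simps)
    finally have 2: "abs2 ((X m - X n) * Y n) < e" by (simp add: abs2_mult)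
    have "X m * Y m - X n * Y n = X m * (Y m - Y n) + (X m - X n) * Y n" by (simp add: algebra_simps)
    then show "abs2 (X m * Y m - X n * Y n) < e"
      using 1 2 abs2_add[of "X m * (Y m - Y n)" "(X m - X n) * Y n"] by simp
  qed
qed

lemma vanishes2_mult:
  assumes "cauchy2 X" "vanishes2 Y" shows "vanishes2 (\<lambda>n. X n * Y n)"
proof -
  obtain a where a: "a > 0" "\<And>n. abs2 (X n) \<le> a" using cauchy2_bounded assms(1) by blast
  show ?thesis unfolding vanishes2_def
  proof (rule Lim_null_comparison)
    show "(\<lambda>n. a * abs2 (Y n)) \<longlonglongrightarrow> 0"
      using tendsto_mult_left[of "\<lambda>n. abs2 (Y n)" 0 _ a] assms by (simp add: vanishes2_def)
    show "\<forall>\<^sub>F n in sequentially. norm (abs2 (X n * Y n)) \<le> a * abs2 (Y n)"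
      using a by (simp add: abs2_mult mult_right_mono)
  qed
qed

lemma abs2_eq_if_close:
  assumes "abs2 (p - q) < abs2 q" shows "abs2 p = abs2 q"
proof -
  have "abs2 p \<le> abs2 q" using abs2_add[of "p - q" q] assms by simp
  moreover have "abs2 q \<le> abs2 p" using abs2_diff[of p "p - q"] assms by simp
  ultimately show ?thesis by simp
qed

lemma cauchy2_not_vanishes:
  assumes "cauchy2 X" "\<not> vanishes2 X"
  obtains b k where "b > 0" "\<And>n. n \<ge> k \<Longrightarrow> abs2 (X n) = b"
proof -
  obtain e where e: "e > 0" "\<And>k. \<exists>n\<ge>k. abs2 (X n) \<ge> e"
    using assms(2) unfolding vanishes2_iff by (meson not_le)
  obtain k where k: "\<And>m n. m \<ge> k \<Longrightarrow> n \<ge> k \<Longrightarrow> abs2 (X m - X n) < e" using cauchy2_D[OF assms(1) e(1)] by blast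
  obtain j where j: "j \<ge> k" "abs2 (X j) \<ge> e" using e(2) by blast
  show ?thesis
  proof (rule that)
    show "abs2 (X j) > 0" using j e by linarith
    show "abs2 (X n) = abs2 (X j)" if "n \<ge> k" for n
      using k[OF that j(1)] j(2) by (intro abs2_eq_if_close) auto
  qed
qed

lemma abs2_inverse_diff:
  assumes "p \<noteq> 0" "q \<noteq> 0" 
  shows "abs2 (inverse p - inverse q) = abs2 (p - q) / (abs2 p * abs2 q)"
proof -
  have "inverse p - inverse q = (q - p) * inverse p * inverse q" using assms by (simp add: field_simps)
  then show ?thesis by (simp add: abs2_mult abs2_inverse abs2_diff_commute[of q p] divide_inverse)
qed

lemma cauchy2_inverse:
  assumes "cauchy2 X" "\<not> vanishes2 X" shows "cauchy2 (\<lambda>n. inverse (X n))"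
  unfolding cauchy2_def
proof (intro allI impI)
  fix e :: real assume e: "0 < e"
  obtain b k where b: "b > 0" "\<And>n. n \<ge> k \<Longrightarrow> abs2 (X n) = b" using cauchy2_not_vanishes[OF assms] by metis
  obtain i where i: "\<And>m n. m \<ge> i \<Longrightarrow> n \<ge> i \<Longrightarrow> abs2 (X m - X n) < e * (b * b)"
    using cauchy2_D[OF assms(1), of "e * (b * b)"] e b by auto
  show "\<exists>k. \<forall>m\<ge>k. \<forall>n\<ge>k. abs2 (inverse (X m) - inverse (X n)) < e"
  proof (intro exI[of _ "max i k"] allI impI)
    fix m n assume mn: "max i k \<le> m" "max i k \<le> n"
    then have ab: "abs2 (X m) = b" "abs2 (X n) = b" using b by auto
    then have "X m \<noteq> 0" "X n \<noteq> 0" using b by auto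
    then show "abs2 (inverse (X m) - inverse (X n)) < e"
      using i[of m n] mn b(1) ab by (simp add: abs2_inverse_diff pos_divide_less_eq)
  qed
qed

lemma vanishes2_inverse_diff:
  assumes "cauchy2 X" "\<not> vanishes2 X" "cauchy2 Y" "\<not> vanishes2 Y" "vanishes2 (\<lambda>n. X n - Y n)"
  shows "vanishes2 (\<lambda>n. inverse (X n) - inverse (Y n))"
proof -
  obtain b k where b: "b > 0" "\<And>n. n \<ge> k \<Longrightarrow> abs2 (X n) = b" using cauchy2_not_vanishes[OF assms(1,2)] by metis
  obtain c l where c: "c > 0" "\<And>n. n \<ge> l \<Longrightarrow> abs2 (Y n) = c" using cauchy2_not_vanishes[OF assms(3,4)] by metis
  have "(\<lambda>n. abs2 (X n - Y n) / (b * c)) \<longlonglongrightarrow> 0"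
    using tendsto_divide_zero assms(5) unfolding vanishes2_def by blast
  moreover have "\<forall>\<^sub>F n in sequentially. abs2 (X n - Y n) / (b * c) = abs2 (inverse (X n) - inverse (Y n))"
    using eventually_ge_at_top[of "max k l"]
  proof eventually_elim
    case (elim n)
    then have ab: "abs2 (X n) = b" "abs2 (Y n) = c" using b c by auto
    then have "X n \<noteq> 0" "Y n \<noteq> 0" using b c by auto
    then show ?case using ab by (simp add: abs2_inverse_diff)
  qed
  ultimately show ?thesis unfolding vanishes2_def by (rule Lim_transform_eventually)
qed

text \<open>\<open>q2\<close> consists of the \<^const>\<open>abs2\<close>-Cauchy sequences of rationals modulo null sequences; \<open>complete_space\<close>
  and the lemmas \<open>q2_dense\<close> and \<open>q2_abs_of_rat\<close> below identify it as the completion.\<close>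

definition q2rel :: "(nat \<Rightarrow> rat) \<Rightarrow> (nat \<Rightarrow> rat) \<Rightarrow> bool" where
  "q2rel X Y \<longleftrightarrow> cauchy2 X \<and> cauchy2 Y \<and> vanishes2 (\<lambda>n. X n - Y n)"

lemma q2rel_refl: "cauchy2 X \<Longrightarrow> q2rel X X"
  by (simp add: q2rel_def vanishes2_def)

lemma q2rel_sym: "q2rel X Y \<Longrightarrow> q2rel Y X"
  unfolding q2rel_def vanishes2_def by (simp add: abs2_diff_commute)

lemma q2rel_trans: "q2rel X Y \<Longrightarrow> q2rel Y Z \<Longrightarrow> q2rel X Z"
  unfolding q2rel_def using vanishes2_add[of "\<lambda>n. X n - Y n" "\<lambda>n. Y n - Z n"] by simp

quotient_type q2 = "nat \<Rightarrow> rat" / partial: q2rel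
  morphisms rep_q2 Q2
proof (rule part_equivpI)
  show "\<exists>X. q2rel X X" using q2rel_refl[OF cauchy2_const[of 0]] by blast
  show "symp q2rel" using q2rel_sym by (rule sympI)
  show "transp q2rel" using q2rel_trans by (rule transpI)
qed

lemma Q2_cases [case_names Q2, cases type: q2]:
  obtains X where "cauchy2 X" "x = Q2 X"
proof (induct x)
  case (1 X)
  then show ?thesis by (auto simp: q2rel_def)
qed

lemma Q2_eq_iff: "cauchy2 X \<Longrightarrow> cauchy2 Y \<Longrightarrow> Q2 X = Q2 Y \<longleftrightarrow> vanishes2 (\<lambda>n. X n - Y n)"
  using q2.rel_eq_transfer by (auto simp: q2.pcr_cr_eq cr_q2_def rel_fun_def q2rel_def vanishes2_def)

instantiation q2 :: field
begin

lift_definition zero_q2 :: q2 is "\<lambda>n. 0" by (simp add: q2rel_refl)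

lift_definition one_q2 :: q2 is "\<lambda>n. 1" by (simp add: q2rel_refl)

lift_definition plus_q2 :: "q2 \<Rightarrow> q2 \<Rightarrow> q2" is "\<lambda>X Y n. X n + Y n"
  unfolding q2rel_def add_diff_add by (simp only: cauchy2_add vanishes2_add simp_thms)

lift_definition uminus_q2 :: "q2 \<Rightarrow> q2" is "\<lambda>X n. - X n"
proof -
  fix X Y assume "q2rel X Y"
  moreover from this have "vanishes2 (\<lambda>n. - (X n - Y n))"
    unfolding q2rel_def by (intro vanishes2_minus) auto
  moreover have "- X n - - Y n = - (X n - Y n)" for n by simp
  ultimately show "q2rel (\<lambda>n. - X n) (\<lambda>n. - Y n)"
    unfolding q2rel_def by (simp only: cauchy2_minus simp_thms)
qed

lift_definition minus_q2 :: "q2 \<Rightarrow> q2 \<Rightarrow> q2" is "\<lambda>X Y n. X n - Y n"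
proof -
  fix X X' Y Y' assume "q2rel X X'" "q2rel Y Y'"
  moreover have "(X n - Y n) - (X' n - Y' n) = (X n - X' n) - (Y n - Y' n)" for n by simp
  ultimately show "q2rel (\<lambda>n. X n - Y n) (\<lambda>n. X' n - Y' n)"
    unfolding q2rel_def by (simp only: cauchy2_diff vanishes2_diff simp_thms)
qed

lift_definition times_q2 :: "q2 \<Rightarrow> q2 \<Rightarrow> q2" is "\<lambda>X Y n. X n * Y n"
proof -
  fix X X' Y Y' assume "q2rel X X'" "q2rel Y Y'"
  moreover from this have "vanishes2 (\<lambda>n. X n * (Y n - Y' n) + Y' n * (X n - X' n))"
    unfolding q2rel_def by (intro vanishes2_add vanishes2_mult) auto
  moreover have "X n * (Y n - Y' n) + Y' n * (X n - X' n) = X n * Y n - X' n * Y' n" for n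
    by (simp add: algebra_simps)
  ultimately show "q2rel (\<lambda>n. X n * Y n) (\<lambda>n. X' n * Y' n)"
    unfolding q2rel_def by (simp add: cauchy2_mult)
qed

lift_definition inverse_q2 :: "q2 \<Rightarrow> q2" is
  "\<lambda>X. if vanishes2 X then (\<lambda>n. 0) else (\<lambda>n. inverse (X n))"
proof -
  fix X Y assume *: "q2rel X Y"
  have "vanishes2 X \<longleftrightarrow> vanishes2 Y"
    using * vanishes2_diff[of X "\<lambda>n. X n - Y n"] vanishes2_add[of "\<lambda>n. X n - Y n" Y]
    by (auto simp: q2rel_def)
  with * show "q2rel (if vanishes2 X then \<lambda>n. 0 else (\<lambda>n. inverse (X n)))
    (if vanishes2 Y then \<lambda>n. 0 else (\<lambda>n. inverse (Y n)))"
    by (auto simp: q2rel_refl) (auto simp: q2rel_def cauchy2_inverse vanishes2_inverse_diff)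
qed

definition divide_q2 :: "q2 \<Rightarrow> q2 \<Rightarrow> q2" where "divide_q2 x y = x * inverse y"

instance
proof
  fix a b c :: q2
  show "a + b + c = a + (b + c)"
    by transfer (simp add: add.assoc q2rel_def vanishes2_def cauchy2_add)
  show "a + b = b + a"
    by transfer (simp add: add.commute q2rel_def vanishes2_def cauchy2_add)
  show "0 + a = a" by transfer (simp add: q2rel_def vanishes2_def)
  show "- a + a = 0" by transfer (simp add: q2rel_def vanishes2_def)
  show "a - b = a + - b" by transfer (simp add: q2rel_def vanishes2_def cauchy2_diff)
  show "a * b * c = a * (b * c)"
    by transfer (simp add: mult.assoc q2rel_def vanishes2_def cauchy2_mult)
  show "a * b = b * a"
    by transfer (simp add: mult.commute q2rel_def vanishes2_def cauchy2_mult)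
  show "1 * a = a" by transfer (simp add: q2rel_def vanishes2_def)
  show "(a + b) * c = a * c + b * c"
    by transfer (simp add: distrib_right q2rel_def vanishes2_def cauchy2_add cauchy2_mult)
  show "(0::q2) \<noteq> 1" by transfer (simp add: q2rel_def vanishes2_def LIMSEQ_const_iff)
  show "inverse (0::q2) = 0" by transfer (simp add: q2rel_def vanishes2_def)
  show "a div b = a * inverse b" by (fact divide_q2_def)
  show "a \<noteq> 0 \<Longrightarrow> inverse a * a = 1"
  proof transfer
    fix X :: "nat \<Rightarrow> rat"
    assume "q2rel X X" "\<not> q2rel X (\<lambda>n. 0)"
    then have X: "cauchy2 X" "\<not> vanishes2 X" by (auto simp: q2rel_def)
    then obtain b k where b: "b > 0" "\<And>n. n \<ge> k \<Longrightarrow> abs2 (X n) = b" using cauchy2_not_vanishes by metis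
    have "vanishes2 (\<lambda>n. inverse (X n) * X n - 1)"
      unfolding vanishes2_iff
    proof (intro allI impI exI[of _ k])
      fix e :: real and n assume "e > 0" "n \<ge> k"
      then have "X n \<noteq> 0" using b(1) b(2)[of n] by auto
      then show "abs2 (inverse (X n) * X n - 1) < e" using \<open>e > 0\<close> by simp
    qed
    then show "q2rel (\<lambda>n. (if vanishes2 X then \<lambda>n. 0 else (\<lambda>n. inverse (X n))) n * X n) (\<lambda>n. 1)"
      using X by (simp add: q2rel_def cauchy2_mult cauchy2_inverse)
  qed
qed

end

lift_definition q2_abs :: "q2 \<Rightarrow> real" is "\<lambda>X. lim (\<lambda>n. abs2 (X n))"
proof -
  fix X Y assume *: "q2rel X Y"
  then have "(\<lambda>n. abs2 (X n - Y n)) \<longlonglongrightarrow> 0" and X: "cauchy2 X" and Y: "cauchy2 Y"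
    by (auto simp: q2rel_def vanishes2_def)
  then have "(\<lambda>n. abs2 (Y n) - abs2 (X n)) \<longlonglongrightarrow> 0"
    by (rule_tac Lim_null_comparison) (auto simp: abs2_abs_diff abs_minus_commute intro!: always_eventually)
  from tendsto_add[OF this convergent_LIMSEQ_iff[THEN iffD1, OF cauchy2_convergent_abs2[OF X]]]
  have "(\<lambda>n. abs2 (Y n)) \<longlonglongrightarrow> lim (\<lambda>n. abs2 (X n))" by simp
  then show "lim (\<lambda>n. abs2 (X n)) = lim (\<lambda>n. abs2 (Y n))" by (simp add: limI)
qed


lemma q2_abs_Q2: "cauchy2 X \<Longrightarrow> q2_abs (Q2 X) = lim (\<lambda>n. abs2 (X n))"
  using q2_abs.transfer by (auto simp: q2.pcr_cr_eq cr_q2_def rel_fun_def q2rel_def vanishes2_def)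

lemma q2_abs_LIMSEQ: "cauchy2 X \<Longrightarrow> (\<lambda>n. abs2 (X n)) \<longlonglongrightarrow> q2_abs (Q2 X)"
  by (simp add: q2_abs_Q2 convergent_LIMSEQ_iff[symmetric] cauchy2_convergent_abs2)

lemma Q2_add: "cauchy2 X \<Longrightarrow> cauchy2 Y \<Longrightarrow> Q2 X + Q2 Y = Q2 (\<lambda>n. X n + Y n)"
  using plus_q2.transfer by (auto simp: q2.pcr_cr_eq cr_q2_def rel_fun_def q2rel_def vanishes2_def)

lemma Q2_diff: "cauchy2 X \<Longrightarrow> cauchy2 Y \<Longrightarrow> Q2 X - Q2 Y = Q2 (\<lambda>n. X n - Y n)"
  using minus_q2.transfer by (auto simp: q2.pcr_cr_eq cr_q2_def rel_fun_def q2rel_def vanishes2_def)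

lemma Q2_mult: "cauchy2 X \<Longrightarrow> cauchy2 Y \<Longrightarrow> Q2 X * Q2 Y = Q2 (\<lambda>n. X n * Y n)"
  using times_q2.transfer by (auto simp: q2.pcr_cr_eq cr_q2_def rel_fun_def q2rel_def vanishes2_def)

lemma q2_abs_nonneg [simp]: "q2_abs x \<ge> 0"
  by (cases x) (auto intro: LIMSEQ_le_const q2_abs_LIMSEQ)

lemma q2_abs_mult: "q2_abs (x * y) = q2_abs x * q2_abs y"
proof (cases x, cases y)
  fix X Y assume X: "cauchy2 X" "x = Q2 X" and Y: "cauchy2 Y" "y = Q2 Y"
  have "(\<lambda>n. abs2 (X n * Y n)) \<longlonglongrightarrow> q2_abs x * q2_abs y"
    using tendsto_mult[OF q2_abs_LIMSEQ q2_abs_LIMSEQ] X Y by (simp add: abs2_mult)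
  moreover have "(\<lambda>n. abs2 (X n * Y n)) \<longlonglongrightarrow> q2_abs (x * y)"
    using q2_abs_LIMSEQ[OF cauchy2_mult[of X Y]] X Y by (simp add: Q2_mult)
  ultimately show ?thesis by (rule LIMSEQ_unique[symmetric])
qed

lemma q2_abs_add: "q2_abs (x + y) \<le> max (q2_abs x) (q2_abs y)"
proof (cases x, cases y)
  fix X Y assume X: "cauchy2 X" "x = Q2 X" and Y: "cauchy2 Y" "y = Q2 Y"
  have "(\<lambda>n. max (abs2 (X n)) (abs2 (Y n))) \<longlonglongrightarrow> max (q2_abs x) (q2_abs y)"
    using tendsto_max[OF q2_abs_LIMSEQ q2_abs_LIMSEQ] X Y by simp
  moreover have "(\<lambda>n. abs2 (X n + Y n)) \<longlonglongrightarrow> q2_abs (x + y)"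
    using q2_abs_LIMSEQ[OF cauchy2_add[of X Y]] X Y by (simp add: Q2_add)
  ultimately show ?thesis using abs2_add by (intro LIMSEQ_le) auto
qed

lemma q2_abs_eq_0_iff [simp]: "q2_abs x = 0 \<longleftrightarrow> x = 0"
proof (cases x)
  case (Q2 X)
  have "q2_abs x = 0 \<longleftrightarrow> vanishes2 X"
    using q2_abs_LIMSEQ[OF Q2(1)] LIMSEQ_unique unfolding vanishes2_def Q2(2) by metis
  also have "\<dots> \<longleftrightarrow> x = 0"
    using Q2 Q2_eq_iff[of X "\<lambda>_. 0"] by (simp add: zero_q2_def)
  finally show ?thesis .
qed

lemma q2_abs_0 [simp]: "q2_abs 0 = 0"
  by simp

lemma q2_abs_1 [simp]: "q2_abs 1 = 1"
proof -
  have "q2_abs 1 * q2_abs 1 = q2_abs 1" by (simp flip: q2_abs_mult)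
  then show ?thesis by simp
qed

lemma q2_abs_minus [simp]: "q2_abs (- x) = q2_abs x"
proof -
  have "q2_abs (-1) * q2_abs (-1) = 1" by (simp flip: q2_abs_mult)
  then have "q2_abs (-1) = 1"
    using q2_abs_nonneg[of "-1"] square_eq_1_iff[of "q2_abs (-1)"] by linarith
  then show ?thesis using q2_abs_mult[of "-1" x] by simp
qed

lemma q2_abs_diff_commute: "q2_abs (x - y) = q2_abs (y - x)"
  using q2_abs_minus[of "x - y"] by simp

lemma q2_abs_diff: "q2_abs (x - y) \<le> max (q2_abs x) (q2_abs y)"
  using q2_abs_add[of x "- y"] by simp

lemma q2_abs_diff3: "q2_abs (x - z) \<le> max (q2_abs (x - y)) (q2_abs (y - z))"
  using q2_abs_add[of "x - y" "y - z"] by simp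

lemma q2_abs_inverse: "q2_abs (inverse x) = inverse (q2_abs x)"
proof (cases "x = 0")
  case False
  then have "q2_abs (inverse x) * q2_abs x = 1" by (simp flip: q2_abs_mult)
  then show ?thesis by (metis inverse_unique mult.commute)
qed auto

lemma q2_abs_divide: "q2_abs (x / y) = q2_abs x / q2_abs y"
  by (simp add: divide_inverse q2_abs_mult q2_abs_inverse)

lemma of_nat_q2: "of_nat n = Q2 (\<lambda>_. of_nat n)"
  by (induct n) (simp_all add: Q2_add zero_q2_def one_q2_def)

instance q2 :: field_char_0
proof
  show "inj (of_nat :: nat \<Rightarrow> q2)"
  proof (rule injI)
    fix m n :: nat assume "(of_nat m :: q2) = of_nat n"
    then have "vanishes2 (\<lambda>_. of_nat m - of_nat n)" by (simp add: of_nat_q2 Q2_eq_iff)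
    then show "m = n" by (simp add: vanishes2_def LIMSEQ_const_iff)
  qed
qed

lemma of_int_q2: "of_int n = Q2 (\<lambda>_. of_int n)"
proof (cases n rule: int_diff_cases)
  case (diff a b)
  then show ?thesis by (simp add: of_nat_q2 Q2_diff)
qed

lemma of_rat_q2: "of_rat r = Q2 (\<lambda>_. r)"
proof -
  obtain a b :: int where r: "r = of_int a / of_int b" "b > 0" by (rule rat_int_frac)
  have "Q2 (\<lambda>_. r) * of_int b = of_int a" using r by (simp add: of_int_q2 Q2_mult)
  moreover have "of_rat r * of_int b = (of_int a :: q2)" using r by (simp add: of_rat_divide)
  ultimately show ?thesis using r by (metis less_irrefl mult_right_cancel of_int_eq_0_iff)
qed

lemma q2_abs_of_rat [simp]: "q2_abs (of_rat r) = abs2 r"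
  by (simp add: of_rat_q2 q2_abs_Q2)

lemma q2_abs_2: "q2_abs 2 = 1 / 2"
  using q2_abs_of_rat[of 2] by (simp add: abs2_2)

lemma q2_abs_2_powi: "q2_abs (2 powi l) = 2 powi (- l)"
proof -
  have "q2_abs (2 ^ n) = (1 / 2) ^ n" for n
    by (induct n) (simp_all add: q2_abs_mult q2_abs_2)
  then show ?thesis
    by (cases l rule: int_cases2) (simp_all add: power_int_minus q2_abs_inverse q2_abs_divide field_simps)
qed

instantiation q2 :: metric_space
begin

definition dist_q2 :: "q2 \<Rightarrow> q2 \<Rightarrow> real" where
  "dist_q2 x y = q2_abs (x - y)"

definition uniformity_q2 :: "(q2 \<times> q2) filter" where
  "uniformity_q2 = (INF e\<in>{0 <..}. principal {(x, y). dist x y < e})"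

definition open_q2 :: "q2 set \<Rightarrow> bool" where
  "open_q2 U \<longleftrightarrow> (\<forall>x\<in>U. eventually (\<lambda>(x', y). x' = x \<longrightarrow> y \<in> U) uniformity)"

instance
proof
  fix x y z :: q2
  show "uniformity = (INF e\<in>{0 <..}. principal {(x, y :: q2). dist x y < e})"
    by (rule uniformity_q2_def)
  show "open U \<longleftrightarrow> (\<forall>x\<in>U. eventually (\<lambda>(x', y). x' = x \<longrightarrow> y \<in> U) uniformity)" for U :: "q2 set"
    by (rule open_q2_def)
  show "dist x y = 0 \<longleftrightarrow> x = y" by (simp add: dist_q2_def)
  show "dist x y \<le> dist x z + dist y z"
    using q2_abs_diff3[of x y z] q2_abs_diff_commute[of y z] q2_abs_nonneg[of "x - z"] q2_abs_nonneg[of "y - z"]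
    unfolding dist_q2_def by linarith
qed

end

instance q2 :: topological_ab_group_add
proof
  fix a b :: q2
  show "((\<lambda>x. fst x + snd x) \<longlongrightarrow> a + b) (nhds a \<times>\<^sub>F nhds b)"
  proof (rule tendstoI)
    fix e :: real assume e: "e > 0"
    have "\<forall>\<^sub>F x in nhds a. dist x a < e" "\<forall>\<^sub>F x in nhds b. dist x b < e"
      using e by (auto simp: eventually_nhds_metric)
    then have "\<forall>\<^sub>F x in nhds a \<times>\<^sub>F nhds b. dist (fst x) a < e \<and> dist (snd x) b < e"
      unfolding eventually_prod_filter by (intro exI conjI) auto
    then show "\<forall>\<^sub>F x in nhds a \<times>\<^sub>F nhds b. dist (fst x + snd x) (a + b) < e"
    proof eventually_elim
      case (elim x)
      have "fst x + snd x - (a + b) = (fst x - a) + (snd x - b)" by simp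
      then have "dist (fst x + snd x) (a + b) \<le> max (dist (fst x) a) (dist (snd x) b)"
        using q2_abs_add[of "fst x - a" "snd x - b"] unfolding dist_q2_def by metis
      then show ?case using elim by linarith
    qed
  qed
  show "(uminus \<longlongrightarrow> - a) (nhds a)"
  proof (rule tendstoI)
    fix e :: real assume e: "e > 0"
    then have "\<forall>\<^sub>F x in nhds a. dist x a < e" by (auto simp: eventually_nhds_metric)
    moreover have "dist (- x) (- a) = dist x a" for x
      using q2_abs_minus[of "x - a"] unfolding dist_q2_def by simp
    ultimately show "\<forall>\<^sub>F x in nhds a. dist (- x) (- a) < e" by simp
  qed
qed

lemma Q2_LIMSEQ:
  assumes "cauchy2 X" shows "(\<lambda>n. of_rat (X n)) \<longlonglongrightarrow> Q2 X"
proof (rule metric_LIMSEQ_I)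
  fix e :: real assume e: "e > 0"
  obtain k where k: "\<And>m n. m \<ge> k \<Longrightarrow> n \<ge> k \<Longrightarrow> abs2 (X m - X n) < e / 2"
    using cauchy2_D[OF assms, of "e / 2"] e by auto
  show "\<exists>k. \<forall>n\<ge>k. dist (of_rat (X n)) (Q2 X) < e"
  proof (intro exI allI impI)
    fix n assume n: "n \<ge> k"
    have "(\<lambda>m. abs2 (X n - X m)) \<longlonglongrightarrow> q2_abs (of_rat (X n) - Q2 X)"
      using q2_abs_LIMSEQ[OF cauchy2_diff[OF cauchy2_const assms]] assms by (simp add: of_rat_q2 Q2_diff)
    then have "q2_abs (of_rat (X n) - Q2 X) \<le> e / 2"
      using k[OF n] by (intro LIMSEQ_le_const2) (auto intro!: exI[of _ k] less_imp_le)
    then show "dist (of_rat (X n)) (Q2 X) < e" using e by (simp add: dist_q2_def)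
  qed
qed

lemma q2_dense:
  assumes "e > 0" obtains r where "q2_abs (x - of_rat r) < e"
proof (cases x)
  case (Q2 X)
  obtain k where "\<forall>n\<ge>k. dist (of_rat (X n)) (Q2 X) < e"
    using metric_LIMSEQ_D[OF Q2_LIMSEQ[OF Q2(1)] assms] by blast
  then have "dist x (of_rat (X k)) < e" using Q2 by (simp add: dist_commute)
  then show ?thesis using that unfolding dist_q2_def by blast
qed

instance q2 :: complete_space
proof
  fix X :: "nat \<Rightarrow> q2" assume X: "Cauchy X"
  have "\<exists>r. q2_abs (X n - of_rat r) < 1 / Suc n" for n
    using q2_dense[of "1 / Suc n" "X n"] by auto
  then obtain r where r: "\<And>n. q2_abs (X n - of_rat (r n)) < 1 / Suc n" by metis
  have c: "cauchy2 r"
    unfolding cauchy2_def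
  proof (intro allI impI)
    fix e :: real assume e: "e > 0"
    obtain k where k: "\<And>m n. m \<ge> k \<Longrightarrow> n \<ge> k \<Longrightarrow> dist (X m) (X n) < e" using metric_CauchyD[OF X e] by blast
    obtain l where l: "inverse (real (Suc l)) < e" using reals_Archimedean e by blast
    have small: "q2_abs (X n - of_rat (r n)) < e" if "n \<ge> l" for n
    proof -
      have "1 / real (Suc n) \<le> 1 / real (Suc l)" using that by (intro divide_left_mono) auto
      then show ?thesis using l r[of n] by (simp add: inverse_eq_divide)
    qed
    show "\<exists>k. \<forall>m\<ge>k. \<forall>n\<ge>k. abs2 (r m - r n) < e"
    proof (intro exI[of _ "max k l"] allI impI)
      fix m n assume mn: "max k l \<le> m" "max k l \<le> n"
      have "q2_abs (of_rat (r m) - of_rat (r n)) \<le> max (q2_abs (of_rat (r m) - X m)) (q2_abs (X m - of_rat (r n)))"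
        by (rule q2_abs_diff3)
      also have "\<dots> \<le> max (q2_abs (of_rat (r m) - X m)) (max (q2_abs (X m - X n)) (q2_abs (X n - of_rat (r n))))"
        using q2_abs_diff3[of "X m" "of_rat (r n)" "X n"] by auto
      also have "\<dots> < e"
        using k[of m n] small[of m] small[of n] mn by (simp add: dist_q2_def q2_abs_diff_commute)
      finally show "abs2 (r m - r n) < e" by (simp flip: q2_abs_of_rat add: of_rat_diff)
    qed
  qed
  have "X \<longlonglongrightarrow> Q2 r"
  proof (rule Lim_transform_eventually)
    have "(\<lambda>n. X n - of_rat (r n)) \<longlonglongrightarrow> 0"
      unfolding tendsto_dist_iff[of _ "0::q2"]
    proof (rule Lim_null_comparison)
      show "(\<lambda>n. 1 / real (Suc n)) \<longlonglongrightarrow> 0" using LIMSEQ_inverse_real_of_nat by (simp add: inverse_eq_divide)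
      show "\<forall>\<^sub>F n in sequentially. norm (dist (X n - of_rat (r n)) 0) \<le> 1 / real (Suc n)"
        using r by (simp add: dist_q2_def less_imp_le)
    qed
    from tendsto_add[OF this Q2_LIMSEQ[OF c]]
    show "(\<lambda>n. X n - of_rat (r n) + of_rat (r n)) \<longlonglongrightarrow> Q2 r" by simp
  qed simp
  then show "convergent X" by (rule convergentI)
qed


section \<open>Balls\<close>

definition Z2 :: "q2 set" where
  "Z2 = {x. q2_abs x \<le> 1}"

definition qball :: "q2 \<Rightarrow> int \<Rightarrow> q2 set" where
  "qball a l = {x. q2_abs (x - a) \<le> 2 powi (- l)}"

lemma qball_center [simp]: "a \<in> qball a l"
  by (simp add: qball_def)

lemma qball_cong:
  assumes "b \<in> qball a l" shows "qball b l = qball a l"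
proof -
  have *: "qball b l \<subseteq> qball a l" if "q2_abs (b - a) \<le> 2 powi (- l)" for a b
  proof
    fix x assume "x \<in> qball b l"
    then have "max (q2_abs (x - b)) (q2_abs (b - a)) \<le> 2 powi (- l)"
      using that by (simp add: qball_def)
    then show "x \<in> qball a l"
      using q2_abs_diff3[of x a b] unfolding qball_def mem_Collect_eq by (rule order_trans[rotated])
  qed
  have "q2_abs (b - a) \<le> 2 powi (- l)" "q2_abs (a - b) \<le> 2 powi (- l)"
    using assms unfolding qball_def q2_abs_diff_commute[of a b] by auto
  then show ?thesis using * by blast
qed

lemma translate_qball: "(+) x ` qball a l = qball (x + a) l"
proof
  show "qball (x + a) l \<subseteq> (+) x ` qball a l"
  proof
    fix y assume "y \<in> qball (x + a) l"
    then show "y \<in> (+) x ` qball a l"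
      by (intro image_eqI[of _ _ "y - x"]) (simp_all add: qball_def diff_diff_eq)
  qed
  have "x + y - (x + a) = y - a" for y by simp
  then show "(+) x ` qball a l \<subseteq> qball (x + a) l" by (simp add: qball_def image_subset_iff)
qed

lemma scale_Z2: "(*) (2 powi l) ` Z2 = qball 0 l"
proof
  show "(*) (2 powi l) ` Z2 \<subseteq> qball 0 l"
  proof
    fix y assume "y \<in> (*) (2 powi l) ` Z2"
    then obtain z where z: "q2_abs z \<le> 1" "y = 2 powi l * z" by (auto simp: Z2_def)
    then have "q2_abs y = 2 powi (- l) * q2_abs z" by (simp only: q2_abs_mult q2_abs_2_powi)
    also have "\<dots> \<le> 2 powi (- l)" using z(1) by (intro mult_left_le) auto
    finally show "y \<in> qball 0 l" by (simp add: qball_def)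
  qed
  show "qball 0 l \<subseteq> (*) (2 powi l) ` Z2"
  proof
    fix y assume "y \<in> qball 0 l"
    then have "q2_abs y \<le> 2 powi (- l)" by (simp add: qball_def)
    then have "q2_abs y / 2 powi (- l) \<le> 1" by (subst pos_divide_le_eq) auto
    then have "y / 2 powi l \<in> Z2" by (simp only: Z2_def q2_abs_divide q2_abs_2_powi mem_Collect_eq)
    then show "y \<in> (*) (2 powi l) ` Z2" by (intro image_eqI[of _ _ "y / 2 powi l"]) auto
  qed
qed

lemma qball_cball: "qball a l = cball a (2 powi (- l))"
  unfolding qball_def cball_def dist_q2_def q2_abs_diff_commute[of a] ..

lemma qball_borel [measurable]: "qball a l \<in> sets borel"
  unfolding qball_cball by simp

lemma open_qball: "open (qball a l)"
  unfolding open_dist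
proof
  fix x assume x: "x \<in> qball a l"
  have "y \<in> qball a l" if "dist y x < 2 powi (- l)" for y
  proof -
    have "y \<in> qball x l" using that by (simp add: qball_def dist_q2_def)
    then show ?thesis using qball_cong[OF x] by simp
  qed
  then show "\<exists>e>0. \<forall>y. dist y x < e \<longrightarrow> y \<in> qball a l"
    by (intro exI[of _ "2 powi (- l)"]) auto
qed

lemma qball_rat: obtains r where "qball a l = qball (of_rat r) l"
proof -
  obtain r where "q2_abs (a - of_rat r) < 2 powi (- l)" using q2_dense[of "2 powi (- l)" a] by auto
  then have "a \<in> qball (of_rat r) l" by (simp add: qball_def)
  then show ?thesis using qball_cong that by blast
qed

definition qbasis :: "q2 set set" where
  "qbasis = {qball a (int l) | a l. True}"

lemma countable_qbasis: "countable qbasis"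
proof -
  have "qbasis \<subseteq> (\<lambda>(r, l). qball (of_rat r) (int l)) ` UNIV"
  proof
    fix B assume "B \<in> qbasis"
    then obtain a l where B: "B = qball a (int l)" by (auto simp: qbasis_def)
    obtain r where "qball a (int l) = qball (of_rat r) (int l)" by (rule qball_rat)
    then show "B \<in> (\<lambda>(r, l). qball (of_rat r) (int l)) ` UNIV" by (auto simp: B intro!: image_eqI[of _ _ "(r, l)"])
  qed
  then show ?thesis by (rule countable_subset) auto
qed

lemma topological_basis_qbasis: "topological_basis qbasis"
proof (rule topological_basisI)
  show "open B" if "B \<in> qbasis" for B using that open_qball by (auto simp: qbasis_def)
  fix U :: "q2 set" and x assume U: "open U" "x \<in> U"
  then obtain e where e: "e > 0" "ball x e \<subseteq> U" using open_contains_ball by blast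
  obtain l where l: "(1 / 2) ^ l < e" using real_arch_pow_inv[of e "1/2"] e by auto
  have "qball x (int l) \<subseteq> ball x e"
    using l by (auto simp: qball_cball power_int_minus power_one_over inverse_eq_divide)
  then show "\<exists>B\<in>qbasis. x \<in> B \<and> B \<subseteq> U"
    using e by (intro bexI[of _ "qball x (int l)"]) (auto simp: qbasis_def)
qed

instance q2 :: second_countable_topology
proof
  show "\<exists>B::q2 set set. countable B \<and> open = generate_topology B"
    using countable_qbasis topological_basis_qbasis
    by (auto intro!: exI[of _ qbasis] simp: topological_basis_imp_subbasis)
qed

lemma abs2_powi: "q \<noteq> 0 \<Longrightarrow> \<exists>k. abs2 q = 2 powi k"
  unfolding abs2_def by auto

lemma q2_abs_eq_if_close:
  assumes "q2_abs (x - y) < q2_abs x" shows "q2_abs y = q2_abs x"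
proof -
  have "q2_abs x \<le> max (q2_abs (x - y)) (q2_abs y)" using q2_abs_add[of "x - y" y] by simp
  moreover have "q2_abs y \<le> max (q2_abs x) (q2_abs (x - y))" using q2_abs_diff[of x "x - y"] by simp
  ultimately show ?thesis using assms by linarith
qed

lemma q2_abs_powi:
  assumes "x \<noteq> 0" shows "\<exists>k. q2_abs x = 2 powi k"
proof -
  have "q2_abs x > 0" using assms q2_abs_nonneg[of x] q2_abs_eq_0_iff[of x] by linarith
  then obtain r where "q2_abs (x - of_rat r) < q2_abs x" using q2_dense by blast
  then have "abs2 r = q2_abs x" using q2_abs_eq_if_close q2_abs_of_rat by metis
  then show ?thesis using abs2_powi[of r] assms by (metis abs2_0 q2_abs_eq_0_iff)
qed

lemma abs2_unit_residue:
  assumes "abs2 r = 1" shows "abs2 (r - 1) \<le> 1 / 2"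
proof -
  obtain a b where ab: "quotient_of r = (a, b)" by (cases "quotient_of r")
  have cop: "coprime a b" and b: "b > 0" and r: "r = of_int a / of_int b"
    using quotient_of_coprime[OF ab] quotient_of_denom_pos[OF ab] quotient_of_div[OF ab] by auto
  have a: "a \<noteq> 0" using assms r by auto
  have *: "(2::real) powi (int (multiplicity 2 b) - int (multiplicity 2 a)) = 2 powi 0"
    using assms r a b by (simp add: abs2_frac)
  have "multiplicity 2 a = multiplicity 2 b"
    using * power_int_strict_increasing[of "int (multiplicity 2 b) - int (multiplicity 2 a)" 0 "2::real"]
      power_int_strict_increasing[of 0 "int (multiplicity 2 b) - int (multiplicity 2 a)" "2::real"]
    by linarith
  have "odd a \<and> odd b"
  proof (rule ccontr)
    assume "\<not> (odd a \<and> odd b)"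
    then have "multiplicity 2 a > 0 \<or> multiplicity 2 b > 0" using a b by (auto simp: multiplicity_gt_zero_iff)
    then have "multiplicity 2 a > 0" "multiplicity 2 b > 0"
      using \<open>multiplicity 2 a = multiplicity 2 b\<close> by auto
    then have "even a" "even b" using a b by (auto simp: multiplicity_gt_zero_iff)
    then show False using cop coprime_common_divisor[of a b 2] by simp
  qed
  have r1: "r - 1 = of_int (a - b) / of_int b" using r b by (simp add: field_simps)
  show ?thesis
  proof (cases "a = b")
    case False
    have "multiplicity 2 b = 0" using \<open>odd a \<and> odd b\<close> by (simp add: not_dvd_imp_multiplicity_0)
    moreover have "multiplicity 2 (a - b) \<ge> 1"
      using False \<open>odd a \<and> odd b\<close> by (intro multiplicity_geI) auto
    ultimately have "abs2 (r - 1) \<le> 2 powi (-1)"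
      unfolding r1 using False b by (subst abs2_frac) (auto simp only: intro!: power_int_increasing)
    then show ?thesis by (simp add: power_int_minus)
  qed (use r1 in simp)
qed

lemma q2_residue:
  assumes "q2_abs x \<le> 1" shows "q2_abs x \<le> 1 / 2 \<or> q2_abs (x - 1) \<le> 1 / 2"
proof (cases "q2_abs x = 1")
  case True
  obtain r where r: "q2_abs (x - of_rat r) < 1 / 2" using q2_dense[of "1 / 2" x] by auto
  then have "q2_abs (of_rat r) = q2_abs x" using True by (intro q2_abs_eq_if_close) auto
  then have "q2_abs (of_rat (r - 1)) \<le> 1 / 2" using abs2_unit_residue[of r] True by simp
  then have "q2_abs (of_rat r - 1) \<le> 1 / 2" by (simp only: of_rat_diff of_rat_1)
  then have "q2_abs (x - 1) \<le> 1 / 2" using r q2_abs_diff3[of x 1 "of_rat r"] by linarith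
  then show ?thesis ..
next
  case False
  show ?thesis
  proof (cases "x = 0")
    case x: False
    obtain k where k: "q2_abs x = 2 powi k" using q2_abs_powi[OF x] by blast
    have "k < 0"
    proof (rule ccontr)
      assume "\<not> k < 0"
      then have "q2_abs x \<ge> 1" unfolding k by (intro one_le_power_int) auto
      then show False using False assms by simp
    qed
    then have "q2_abs x \<le> 2 powi (-1)" unfolding k by (intro power_int_increasing) auto
    then show ?thesis by (simp add: power_int_minus)
  qed simp
qed

lemma powi_minus_Suc: "2 powi (- (l + 1)) = 2 powi (- l) / (2::real)"
proof -
  have "- (l + 1) = - l - 1" by simp
  then have "2 powi (- (l + 1)) = (2::real) powi (- l - 1)" by (rule arg_cong)
  also have "\<dots> = 2 powi (- l) / 2 powi 1" by (rule power_int_diff) simp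
  finally show ?thesis by simp
qed

lemma qball_split:
  "qball a l = qball a (l + 1) \<union> qball (a + 2 powi l) (l + 1)"
  "qball a (l + 1) \<inter> qball (a + 2 powi l) (l + 1) = {}"
proof -
  have p: "(2::real) powi (- l) > 0" by simp
  have t: "2 powi l * (2::real) powi (- l) = 1" by (simp add: power_int_minus)
  show "qball a l = qball a (l + 1) \<union> qball (a + 2 powi l) (l + 1)"
  proof (rule set_eqI)
    fix x
    define u where "u = (x - a) / 2 powi l"
    have x: "x - a = u * 2 powi l" by (simp add: u_def)
    then have x': "x - (a + 2 powi l) = (u - 1) * 2 powi l" by (simp add: algebra_simps)
    have "q2_abs u \<le> 1 / 2 \<Longrightarrow> q2_abs u \<le> 1" by simp
    moreover have "q2_abs (u - 1) \<le> 1 / 2 \<Longrightarrow> q2_abs u \<le> 1" using q2_abs_add[of "u - 1" 1] by simp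
    ultimately have "q2_abs u \<le> 1 \<longleftrightarrow> q2_abs u \<le> 1 / 2 \<or> q2_abs (u - 1) \<le> 1 / 2"
      using q2_residue[of u] by blast
    then show "x \<in> qball a l \<longleftrightarrow> x \<in> qball a (l + 1) \<union> qball (a + 2 powi l) (l + 1)"
      using p unfolding qball_def Un_iff mem_Collect_eq x x' q2_abs_mult q2_abs_2_powi powi_minus_Suc
      by (simp add: field_simps)
  qed
  have False if "x \<in> qball a (l + 1)" "x \<in> qball (a + 2 powi l) (l + 1)" for x
  proof -
    have "q2_abs (2 powi l) \<le> max (q2_abs (x - a)) (q2_abs (x - (a + 2 powi l)))"
      using q2_abs_diff[of "x - a" "x - (a + 2 powi l)"] by simp
    also have "\<dots> \<le> 2 powi (- l) / 2" using that unfolding qball_def powi_minus_Suc by simp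
    finally show False using p unfolding q2_abs_2_powi by linarith
  qed
  then show "qball a (l + 1) \<inter> qball (a + 2 powi l) (l + 1) = {}" by blast
qed

lemma Z2_int_approx:
  assumes "q2_abs x \<le> 1" shows "\<exists>k\<in>{0..<2 ^ l}. q2_abs (x - of_int k) \<le> 2 powi (- int l)"
proof (induct l)
  case 0
  then show ?case using assms by (intro bexI[of _ 0]) auto
next
  case (Suc l)
  then obtain k where k: "k \<in> {0..<2 ^ l}" "x \<in> qball (of_int k) (int l)"
    by (auto simp: qball_def)
  then consider "x \<in> qball (of_int k) (int l + 1)" | "x \<in> qball (of_int k + 2 powi (int l)) (int l + 1)"
    using qball_split(1)[of "of_int k" "int l"] by blast
  then show ?case
  proof cases
    case 1
    then show ?thesis using k by (intro bexI[of _ k]) (auto simp: qball_def add.commute)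
  next
    case 2
    then show ?thesis using k by (intro bexI[of _ "k + 2 ^ l"]) (auto simp: qball_def add.commute)
  qed
qed

lemma abs2_of_int_le_iff: "abs2 (of_int z) \<le> 2 powi (- int l) \<longleftrightarrow> 2 ^ l dvd z"
proof (cases "z = 0")
  case False
  then have "abs2 (of_int z) = 2 powi (- int (multiplicity 2 z))" using abs2_frac[of z 1] by simp
  moreover have "(2::real) powi (- int m) \<le> 2 powi (- int l) \<longleftrightarrow> l \<le> m" for m
    using power_int_increasing[of "- int m" "- int l" "2::real"]
      power_int_strict_increasing[of "- int l" "- int m" "2::real"] by linarith
  ultimately show ?thesis using False by (simp add: power_dvd_iff_le_multiplicity)
qed simp

section \<open>The normalised Haar measure\<close>

definition normalized_haar2 :: "q2 measure \<Rightarrow> bool" where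
  "normalized_haar2 M \<longleftrightarrow>
     sets M = sets borel \<and>
     (\<forall>x. \<forall>A\<in>sets borel. emeasure M ((+) x ` A) = emeasure M A) \<and>
     (\<forall>l. emeasure M ((*) (2 powi l) ` Z2) = ennreal (2 powi (- l)))"

lemma measure_eq_qballI:
  assumes M: "sets M = sets borel" and N: "sets N = sets borel"
    and eq: "\<And>a l. emeasure M (qball a (int l)) = emeasure N (qball a (int l))"
    and fin: "\<And>a. emeasure M (qball a 0) \<noteq> \<infinity>"
  shows "M = N"
proof (rule measure_eqI_generator_eq)
  let ?E = "insert {} qbasis"
  define A where "A n = qball (of_rat (from_nat_into UNIV n)) 0" for n
  show "Int_stable ?E"
  proof -
    have *: "qball a (int k) \<inter> qball b (int l) \<in> ?E" if "k \<le> l" for a b k l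
    proof (cases "qball a (int k) \<inter> qball b (int l) = {}")
      case False
      then obtain c where c: "c \<in> qball a (int k)" "c \<in> qball b (int l)" by blast
      have "qball b (int l) = qball c (int l)" "qball a (int k) = qball c (int k)"
        using qball_cong c by auto
      moreover have "qball c (int l) \<subseteq> qball c (int k)"
        unfolding qball_cball using that by (intro subset_cball power_int_increasing) auto
      ultimately have "qball a (int k) \<inter> qball b (int l) = qball c (int l)" by auto
      then show ?thesis unfolding qbasis_def by blast
    qed simp
    then have "qball a (int k) \<inter> qball b (int l) \<in> ?E" for a b k l
      using *[of k l a b] *[of l k b a] by (cases "k \<le> l") (auto simp: Int_commute)
    moreover have "\<exists>a l. B = qball a (int l)" if "B \<in> qbasis" for B
      using that by (auto simp: qbasis_def)
    ultimately show ?thesis unfolding Int_stable_def by (metis insertE insertI1 inf_bot_left inf_bot_right)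
  qed
  show "?E \<subseteq> Pow UNIV" by simp
  show "emeasure M X = emeasure N X" if "X \<in> ?E" for X using that eq by (auto simp: qbasis_def)
  have *: "sigma_sets UNIV ?E = sets (borel :: q2 measure)"
    unfolding borel_eq_countable_basis[OF countable_qbasis topological_basis_qbasis]
    by (simp, intro sigma_sets_eqI) (auto intro: sigma_sets.Basic sigma_sets.Empty)
  show "sets M = sigma_sets UNIV ?E" "sets N = sigma_sets UNIV ?E" using * M N by auto
  have "A n \<in> qbasis" for n 
    unfolding A_def qbasis_def by (rule CollectI, intro exI[of _ "of_rat _"] exI[of _ 0]) simp
  then show "range A \<subseteq> ?E" by auto
  show "(\<Union>n. A n) = UNIV"
  proof -
    have "x \<in> (\<Union>n. A n)" for x
    proof -
      obtain r where r: "qball x 0 = qball (of_rat r) 0" by (rule qball_rat)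
      have "x \<in> A (to_nat_on UNIV r)" using r qball_center[of x 0] unfolding A_def by simp
      then show ?thesis by blast
    qed
    then show ?thesis by blast
  qed
  show "emeasure M (A n) \<noteq> \<infinity>" for n using fin by (simp add: A_def)
qed

lemma normalized_haar2_qball:
  assumes "normalized_haar2 M" shows "emeasure M (qball a l) = ennreal (2 powi (- l))"
proof -
  have "emeasure M (qball a l) = emeasure M ((+) a ` qball 0 l)" by (simp add: translate_qball)
  also have "\<dots> = emeasure M (qball 0 l)"
    using assms qball_borel[of 0 l] unfolding normalized_haar2_def by blast
  also have "\<dots> = ennreal (2 powi (- l))"
    using assms unfolding normalized_haar2_def scale_Z2 by blast
  finally show ?thesis .
qed

lemma normalized_haar2_unique:
  assumes "normalized_haar2 M" "normalized_haar2 N" shows "M = N"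
  using assms normalized_haar2_qball[OF assms(1)] normalized_haar2_qball[OF assms(2)]
  by (intro measure_eq_qballI) (simp_all add: normalized_haar2_def)

lemma normalized_haar2I:
  assumes M: "sets M = sets borel"
    and ball: "\<And>a l. emeasure M (qball a (int l)) = ennreal (2 powi (- int l))"
  shows "normalized_haar2 M"
  unfolding normalized_haar2_def scale_Z2
proof (intro conjI allI ballI M)
  have neg: "\<forall>a. emeasure M (qball a (- int n)) = ennreal (2 powi (int n))" for n
  proof (induct n)
    case 0
    then show ?case using ball[of _ 0] by simp
  next
    case (Suc n)
    have e: "- int (Suc n) + 1 = - int n" by simp
    show ?case
    proof
      fix a
      have "emeasure M (qball a (- int (Suc n))) =
          emeasure M (qball a (- int n)) + emeasure M (qball (a + 2 powi (- int (Suc n))) (- int n))"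
        using qball_split(2)[of a "- int (Suc n)"] unfolding qball_split(1)[of a "- int (Suc n)"] e
        by (subst plus_emeasure) (auto simp: M)
      also have "\<dots> = ennreal (2 powi (int n) + 2 powi (int n))"
        using Suc by (simp del: power_int_of_nat flip: ennreal_plus)
      also have "(2::real) powi (int n) + 2 powi (int n) = 2 powi (int (Suc n))"
        by (simp only: power_int_of_nat power_Suc)
      finally show "emeasure M (qball a (- int (Suc n))) = ennreal (2 powi (int (Suc n)))" .
    qed
  qed
  show "emeasure M (qball 0 l) = ennreal (2 powi (- l))" for l
    using ball neg by (cases l rule: int_cases2) auto
  fix x :: q2 and A :: "q2 set" assume A: "A \<in> sets borel"
  have m: "(\<lambda>y. - x + y) \<in> borel_measurable M" 
    unfolding measurable_cong_sets[OF M refl] by (intro borel_measurable_continuous_onI continuous_intros)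
  have vim: "(\<lambda>y. - x + y) -` B \<inter> space M = (+) x ` B" for B
  proof -
    have "space M = UNIV" using sets_eq_imp_space_eq[OF M] by simp
    moreover have "y \<in> (+) x ` B" if "- x + y \<in> B" for y
      using that by (intro image_eqI[of _ _ "- x + y"]) auto
    ultimately show ?thesis by auto
  qed
  have d: "emeasure (distr M borel (\<lambda>y. - x + y)) B = emeasure M ((+) x ` B)" if "B \<in> sets borel" for B
    using that by (simp only: emeasure_distr[OF m] vim)
  have "M = distr M borel (\<lambda>y. - x + y)"
  proof (rule measure_eq_qballI)
    show "emeasure M (qball a (int l)) = emeasure (distr M borel (\<lambda>y. - x + y)) (qball a (int l))" for a l
      by (simp only: d qball_borel translate_qball ball)
    show "emeasure M (qball a 0) \<noteq> \<infinity>" for a using ball[of a 0] by simp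
  qed (simp_all add: M)
  then show "emeasure M ((+) x ` A) = emeasure M A" using d[OF A] by simp
qed


subsection \<open>Existence\<close>

text \<open>The measure is obtained from Lebesgue measure on \<open>[0,\<infinity>)\<close>: the fractional part of a real number is
  mapped to \<^const>\<open>Z2\<close> by reversing its binary digits, its integer part selects a coset of \<^const>\<open>Z2\<close>.\<close>

primrec digit_rev :: "nat \<Rightarrow> real \<Rightarrow> int" where
  "digit_rev 0 y = 0"
| "digit_rev (Suc l) y = digit_rev l y + (\<lfloor>y * 2 ^ Suc l\<rfloor> mod 2) * 2 ^ l"

lemma digit_rev_range: "digit_rev l y \<in> {0..<2 ^ l}"
proof (induct l)
  case (Suc l)
  have "\<lfloor>y * 2 ^ Suc l\<rfloor> mod 2 = 0 \<or> \<lfloor>y * 2 ^ Suc l\<rfloor> mod 2 = 1" by presburger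
  with Suc show ?case by auto
qed simp

lemma digit_rev_level:
  assumes "k \<in> {0..<2 ^ l}"
  shows "\<exists>j\<in>{0..<2 ^ l}. \<forall>y. 0 \<le> y \<longrightarrow> y < 1 \<longrightarrow> (digit_rev l y = k \<longleftrightarrow> \<lfloor>y * 2 ^ l\<rfloor> = j)"
  using assms
proof (induct l arbitrary: k)
  case 0
  then show ?case by (intro bexI[of _ 0]) (auto simp: floor_eq_iff)
next
  case (Suc l)
  define k' b where "k' = k mod 2 ^ l" and "b = k div 2 ^ l"
  have k: "k = k' + b * 2 ^ l" unfolding k'_def b_def by (simp only: mod_mult_div_eq add.commute mod_div_mult_eq)
  have k': "k' \<in> {0..<2 ^ l}" by (simp add: k'_def)
  have "0 \<le> b" using Suc.prems by (simp add: b_def pos_imp_zdiv_nonneg_iff)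
  moreover have "b < 2"
  proof (rule ccontr)
    assume "\<not> b < 2"
    then have "2 * 2 ^ l \<le> b * 2 ^ l" by (intro mult_right_mono) auto
    moreover have "k < 2 * 2 ^ l" using Suc.prems by simp
    moreover have "0 \<le> k'" using k' by simp
    ultimately show False using k by linarith
  qed
  ultimately have b: "b = 0 \<or> b = 1" by linarith
  obtain j where j: "j \<in> {0..<2 ^ l}"
    "\<And>y. 0 \<le> y \<Longrightarrow> y < 1 \<Longrightarrow> digit_rev l y = k' \<longleftrightarrow> \<lfloor>y * 2 ^ l\<rfloor> = j"
    using Suc.hyps[OF k'] by blast
  show ?case
  proof (intro bexI[of _ "2 * j + b"] allI impI)
    fix y :: real assume y: "0 \<le> y" "y < 1"
    define t where "t = \<lfloor>y * 2 ^ Suc l\<rfloor>"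
    have t: "\<lfloor>y * 2 ^ l\<rfloor> = t div 2"
    proof -
      have "y * 2 ^ l = y * 2 ^ Suc l / real_of_int 2" by simp
      then show ?thesis unfolding t_def by (metis floor_divide_real_eq_div zero_le_numeral)
    qed
    have "t mod 2 = 0 \<or> t mod 2 = 1" by presburger
    moreover have "digit_rev l y \<in> {0..<2 ^ l}" by (rule digit_rev_range)
    ultimately have "digit_rev l y + (t mod 2) * 2 ^ l = k' + b * 2 ^ l \<longleftrightarrow> digit_rev l y = k' \<and> t mod 2 = b"
      using b k' by auto
    also have "\<dots> \<longleftrightarrow> t div 2 = j \<and> t mod 2 = b" using j(2)[OF y] t by simp
    also have "\<dots> \<longleftrightarrow> t = 2 * j + b" using b by presburger
    finally show "digit_rev (Suc l) y = k \<longleftrightarrow> \<lfloor>y * 2 ^ Suc l\<rfloor> = 2 * j + b"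
      by (simp add: k t_def)
  qed (use j b in auto)
qed

lemma digit_rev_dvd: "l \<le> m \<Longrightarrow> 2 ^ l dvd digit_rev m y - digit_rev l y"
proof (induct m rule: dec_induct)
  case (step m)
  have "(2::int) ^ l dvd (\<lfloor>y * 2 ^ Suc m\<rfloor> mod 2) * 2 ^ m"
    using step by (intro dvd_mult le_imp_power_dvd)
  moreover have "digit_rev (Suc m) y - digit_rev l y
      = (digit_rev m y - digit_rev l y) + (\<lfloor>y * 2 ^ Suc m\<rfloor> mod 2) * 2 ^ m" by simp
  ultimately show ?case using step dvd_add by metis
qed simp

lemma half_powi: "2 powi (- int l) = (1 / 2 :: real) ^ l"
  by (simp add: power_int_minus power_one_over inverse_eq_divide)

lemma digit_rev_abs2:
  assumes "l \<le> m" shows "abs2 (of_int (digit_rev m y) - of_int (digit_rev l y)) \<le> (1 / 2) ^ l"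
  using digit_rev_dvd[OF assms, of y] abs2_of_int_le_iff[of "digit_rev m y - digit_rev l y" l]
  by (simp only: of_int_diff half_powi)

lemma digit_rev_cauchy2: "cauchy2 (\<lambda>l. of_int (digit_rev l y))"
  unfolding cauchy2_def
proof (intro allI impI)
  fix e :: real assume "e > 0"
  then obtain k where k: "(1 / 2) ^ k < e" using real_arch_pow_inv[of e "1/2"] by auto
  show "\<exists>k. \<forall>m\<ge>k. \<forall>n\<ge>k. abs2 (of_int (digit_rev m y) - of_int (digit_rev n y)) < e"
  proof (intro exI[of _ k] allI impI)
    fix m n assume mn: "k \<le> m" "k \<le> n"
    have "abs2 (of_int (digit_rev m y) - of_int (digit_rev n y)) =
        abs2 ((of_int (digit_rev m y) - of_int (digit_rev k y)) - (of_int (digit_rev n y) - of_int (digit_rev k y)))"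
      by simp
    also have "\<dots> \<le> (1 / 2) ^ k"
      by (rule order_trans[OF abs2_diff]) (use digit_rev_abs2 mn in simp)
    finally show "abs2 (of_int (digit_rev m y) - of_int (digit_rev n y)) < e" using k by simp
  qed
qed

definition frac_to_Z2 :: "real \<Rightarrow> q2" where
  "frac_to_Z2 y = Q2 (\<lambda>l. of_int (digit_rev l y))"

lemma frac_to_Z2_LIMSEQ: "(\<lambda>l. of_int (digit_rev l y)) \<longlonglongrightarrow> frac_to_Z2 y"
  using Q2_LIMSEQ[OF digit_rev_cauchy2] by (simp add: frac_to_Z2_def)

lemma frac_to_Z2_approx: "q2_abs (frac_to_Z2 y - of_int (digit_rev l y)) \<le> 2 powi (- int l)"
proof -
  have "(\<lambda>m. abs2 (of_int (digit_rev m y) - of_int (digit_rev l y))) \<longlonglongrightarrow>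
      q2_abs (frac_to_Z2 y - of_int (digit_rev l y))"
    using q2_abs_LIMSEQ[OF cauchy2_diff[OF digit_rev_cauchy2 cauchy2_const]]
    by (simp add: frac_to_Z2_def of_int_q2 Q2_diff digit_rev_cauchy2)
  then show ?thesis
    unfolding half_powi using digit_rev_abs2 by (intro LIMSEQ_le_const2) (auto intro!: exI[of _ l])
qed

lemma frac_to_Z2_qball:
  assumes "q2_abs b \<le> 1"
  shows "\<exists>j\<in>{0..<2 ^ l}. \<forall>y. 0 \<le> y \<longrightarrow> y < 1 \<longrightarrow> (frac_to_Z2 y \<in> qball b (int l) \<longleftrightarrow> \<lfloor>y * 2 ^ l\<rfloor> = j)"
proof -
  obtain k where k: "k \<in> {0..<2 ^ l}" "q2_abs (b - of_int k) \<le> 2 powi (- int l)"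
    using Z2_int_approx[OF assms] by blast
  have "frac_to_Z2 y \<in> qball b (int l) \<longleftrightarrow> digit_rev l y = k" for y
  proof -
    let ?d = "digit_rev l y"
    have eq: "qball b (int l) = qball (of_int k) (int l)" "qball (frac_to_Z2 y) (int l) = qball (of_int ?d) (int l)"
      using k(2) frac_to_Z2_approx[of y l] by (intro qball_cong; simp add: qball_def)+
    have "frac_to_Z2 y \<in> qball b (int l) \<longleftrightarrow> of_int ?d \<in> qball b (int l)"
      using qball_cong[of "frac_to_Z2 y" b "int l"] qball_cong[of "of_int ?d" b "int l"] eq(2)
        qball_center[of "frac_to_Z2 y" "int l"] qball_center[of "of_int ?d" "int l"] by metis
    also have "\<dots> \<longleftrightarrow> q2_abs (of_rat (of_int (?d - k))) \<le> 2 powi (- int l)"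
    proof -
      have "(of_rat (of_int (?d - k)) :: q2) = of_int ?d - of_int k" by (simp only: of_rat_of_int_eq) simp
      then show ?thesis unfolding eq(1) by (simp only: qball_def mem_Collect_eq)
    qed
    also have "\<dots> \<longleftrightarrow> 2 ^ l dvd ?d - k" by (simp only: q2_abs_of_rat abs2_of_int_le_iff)
    also have "\<dots> \<longleftrightarrow> ?d mod 2 ^ l = k mod 2 ^ l" by (simp only: mod_eq_dvd_iff)
    also have "\<dots> \<longleftrightarrow> ?d = k" using k(1) digit_rev_range[of l y] by simp
    finally show ?thesis .
  qed
  then show ?thesis using digit_rev_level[OF k(1)] by simp
qed

lemma coset_enumeration: "\<exists>c :: nat \<Rightarrow> q2. \<forall>a. \<exists>!n. q2_abs (a - c n) \<le> 1"
proof -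
  define B where "B = range (\<lambda>a. qball a 0)"
  have "B \<subseteq> range (\<lambda>r. qball (of_rat r) 0)"
  proof
    fix X assume "X \<in> B"
    then obtain a where "X = qball a 0" by (auto simp: B_def)
    moreover obtain r where "qball a 0 = qball (of_rat r) 0" by (rule qball_rat)
    ultimately show "X \<in> range (\<lambda>r. qball (of_rat r) 0)" by blast
  qed
  then have cB: "countable B" by (rule countable_subset) auto
  have "inj (\<lambda>n :: nat. qball (1 / 2 ^ n) 0)"
  proof (rule injI)
    have *: False if mn: "m < n" and eq: "qball (1 / 2 ^ m) 0 = qball (1 / 2 ^ n) 0" for m n :: nat
    proof -
      have a: "q2_abs (1 / 2 ^ k) = 2 ^ k" for k :: nat
        using q2_abs_2_powi[of "- int k"] by (simp add: power_int_minus inverse_eq_divide)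
      have lt: "(2::real) ^ m < 2 ^ n" "(1::real) < 2 ^ n" using mn by auto
      have "(1 / 2 ^ n :: q2) \<in> qball (1 / 2 ^ m) 0" using eq by simp
      then have "q2_abs (1 / 2 ^ n - 1 / 2 ^ m) \<le> 1" by (simp add: qball_def)
      then have "q2_abs (1 / 2 ^ n) \<le> max 1 (q2_abs (1 / 2 ^ m))"
        using q2_abs_add[of "1 / 2 ^ n - 1 / 2 ^ m" "1 / 2 ^ m"] by (simp only: diff_add_cancel)
      then show False using lt unfolding a by linarith
    qed
    fix m n :: nat assume "qball (1 / 2 ^ m) 0 = qball (1 / 2 ^ n) 0"
    then show "m = n" using *[of m n] *[of n m] by (metis linorder_neqE_nat)
  qed
  then have "infinite (range (\<lambda>n :: nat. qball (1 / 2 ^ n) 0))" by (rule range_inj_infinite)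
  moreover have "range (\<lambda>n :: nat. qball (1 / 2 ^ n) 0) \<subseteq> B" by (auto simp: B_def)
  ultimately have iB: "infinite B" using infinite_super by blast
  have bij: "bij_betw (from_nat_into B) UNIV B" using bij_betw_from_nat_into[OF cB iB] .
  define c where "c n = (SOME a. qball a 0 = from_nat_into B n)" for n
  have c: "qball (c n) 0 = from_nat_into B n" for n
  proof -
    have "from_nat_into B n \<in> B" using bij by (auto simp: bij_betw_def)
    then have "\<exists>a. qball a 0 = from_nat_into B n" by (auto simp: B_def)
    then show ?thesis unfolding c_def by (rule someI_ex)
  qed
  have "\<exists>!n. q2_abs (a - c n) \<le> 1" for a
  proof -
    have "q2_abs (a - c n) \<le> 1 \<longleftrightarrow> from_nat_into B n = qball a 0" for n
    proof -
      have "q2_abs (a - c n) \<le> 1 \<longleftrightarrow> a \<in> qball (c n) 0" by (simp add: qball_def)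
      also have "\<dots> \<longleftrightarrow> qball (c n) 0 = qball a 0" using qball_cong qball_center by metis
      finally show ?thesis by (simp add: c)
    qed
    moreover have "\<exists>!n. from_nat_into B n = qball a 0"
    proof -
      have "qball a 0 \<in> B" by (simp add: B_def)
      then have "qball a 0 \<in> range (from_nat_into B)" using bij by (simp only: bij_betw_def)
      then have "\<exists>n. from_nat_into B n = qball a 0" by (metis imageE)
      moreover have "inj (from_nat_into B)" using bij by (rule bij_betw_imp_inj_on)
      ultimately show ?thesis by (metis injD)
    qed
    ultimately show ?thesis by simp
  qed
  then show ?thesis by blast
qed

lemma normalized_haar2_exists: "\<exists>M. normalized_haar2 M"
proof -
  obtain c :: "nat \<Rightarrow> q2" where c: "\<And>a. \<exists>!n. q2_abs (a - c n) \<le> 1" using coset_enumeration by blast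
  define h where "h x = c (nat \<lfloor>x\<rfloor>) + frac_to_Z2 (frac x)" for x
  have dm: "digit_rev l \<in> borel \<rightarrow>\<^sub>M count_space UNIV" for l
  proof (induct l)
    case (Suc l)
    note [measurable] = this
    show ?case by (simp only: digit_rev.simps(2)[abs_def]) measurable
  qed (simp add: digit_rev.simps(1)[abs_def])
  have "(\<lambda>y. of_int (digit_rev l y) :: q2) \<in> borel_measurable borel" for l
    by (rule measurable_compose[OF dm]) simp
  then have [measurable]: "frac_to_Z2 \<in> borel_measurable borel"
    by (rule borel_measurable_LIMSEQ_metric) (rule frac_to_Z2_LIMSEQ)
  have [measurable]: "(\<lambda>x::real. c (nat \<lfloor>x\<rfloor>)) \<in> borel_measurable borel"
    using measurable_compose[OF measurable_real_floor, of "\<lambda>i. c (nat i)" borel] by simp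
  have hm: "h \<in> borel_measurable (borel :: real measure)"
    unfolding h_def frac_def by measurable
  define L where "L = restrict_space lborel {0::real..}"
  define M where "M = distr L borel h"
  have hL: "h \<in> borel_measurable L" unfolding L_def by (intro measurable_restrict_space1) (simp add: hm)
  have "normalized_haar2 M"
  proof (rule normalized_haar2I)
    show "sets M = sets borel" by (simp add: M_def)
    fix a l
    obtain n where n: "q2_abs (a - c n) \<le> 1" "\<And>m. q2_abs (a - c m) \<le> 1 \<Longrightarrow> m = n" using c[of a] by blast
    obtain j where j: "j \<in> {0..<2 ^ l}"
      "\<And>y. 0 \<le> y \<Longrightarrow> y < 1 \<Longrightarrow> frac_to_Z2 y \<in> qball (a - c n) (int l) \<longleftrightarrow> \<lfloor>y * 2 ^ l\<rfloor> = j"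
      using frac_to_Z2_qball[OF n(1), of l] by blast
    define s t :: real where "s = n + j / 2 ^ l" and "t = n + (j + 1) / 2 ^ l"
    have j1: "0 \<le> j / (2::real) ^ l" "(j + 1) / (2::real) ^ l \<le> 1"
    proof -
      have "real_of_int (j + 1) \<le> real_of_int (2 ^ l)" using j(1) by (subst of_int_le_iff) auto
      then show "(j + 1) / (2::real) ^ l \<le> 1" by simp
    qed (use j(1) in simp)
    have st: "x \<in> {s..<t} \<longleftrightarrow> j \<le> (x - n) * 2 ^ l \<and> (x - n) * 2 ^ l < j + 1" for x :: real
    proof -
      have "x \<in> {s..<t} \<longleftrightarrow> j / 2 ^ l \<le> x - n \<and> x - n < (j + 1) / 2 ^ l"
        unfolding s_def t_def by auto
      then show ?thesis by (simp add: pos_divide_le_eq pos_less_divide_eq)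
    qed
    have "x \<in> {s..<t} \<longleftrightarrow> x \<ge> 0 \<and> h x \<in> qball a (int l)" for x
    proof
      assume xst: "x \<in> {s..<t}"
      then have x: "s \<le> x" "x < t" by auto
      have "real n \<le> x" "x < real n + 1" using x j1 unfolding s_def t_def by linarith+
      then have fl: "\<lfloor>x\<rfloor> = int n" by (intro floor_unique) auto
      then have f: "frac x = x - n" by (simp add: frac_def)
      have "\<lfloor>frac x * 2 ^ l\<rfloor> = j"
        using xst[unfolded st] unfolding f floor_eq_iff by simp
      then have "frac_to_Z2 (frac x) \<in> qball (a - c n) (int l)"
        using j(2)[of "frac x"] frac_ge_0 frac_lt_1 by blast
      then have "h x \<in> qball a (int l)" using fl by (simp add: h_def qball_def algebra_simps)
      moreover have "x \<ge> 0" using x(1) j1(1) unfolding s_def by simp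
      ultimately show "x \<ge> 0 \<and> h x \<in> qball a (int l)" by simp
    next
      assume x: "x \<ge> 0 \<and> h x \<in> qball a (int l)"
      have "q2_abs (a - c (nat \<lfloor>x\<rfloor>)) \<le> 1"
      proof -
        have "q2_abs (a - h x) \<le> 2 powi (- int l)" using x by (simp add: qball_def q2_abs_diff_commute[of a])
        also have "\<dots> \<le> 1" by (simp add: half_powi power_le_one)
        finally have 1: "q2_abs (a - h x) \<le> 1" .
        have "q2_abs (frac_to_Z2 (frac x)) \<le> 1" using frac_to_Z2_approx[of "frac x" 0] by simp
        then have "q2_abs ((a - h x) + frac_to_Z2 (frac x)) \<le> 1"
          using 1 by (intro order_trans[OF q2_abs_add]) simp
        moreover have "(a - h x) + frac_to_Z2 (frac x) = a - c (nat \<lfloor>x\<rfloor>)" by (simp add: h_def)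
        ultimately show ?thesis by (simp only:)
      qed
      then have "nat \<lfloor>x\<rfloor> = n" by (rule n(2))
      then have fl: "\<lfloor>x\<rfloor> = int n" using x by auto
      then have f: "frac x = x - n" by (simp add: frac_def)
      have "frac_to_Z2 (frac x) \<in> qball (a - c n) (int l)"
        using x fl by (simp add: h_def qball_def algebra_simps)
      then have "\<lfloor>frac x * 2 ^ l\<rfloor> = j" using j(2)[of "frac x"] frac_ge_0 frac_lt_1 by blast
      then show "x \<in> {s..<t}" unfolding st f floor_eq_iff by simp
    qed
    note mem = this
    have "space L = {0..}" by (simp add: L_def space_restrict_space)
    then have eq: "h -` qball a (int l) \<inter> space L = {s..<t}"
      by (intro set_eqI) (simp only: mem Int_iff vimage_eq atLeast_iff conj_commute)
    have s0: "{s..<t} \<subseteq> {0..}" using j1(1) by (auto simp: s_def)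
    have "emeasure M (qball a (int l)) = emeasure L {s..<t}"
      unfolding M_def by (simp add: emeasure_distr[OF hL] eq)
    also have "\<dots> = emeasure lborel {s..<t}"
      unfolding L_def using s0 by (intro emeasure_restrict_space) auto
    also have "\<dots> = ennreal (t - s)" by (intro emeasure_lborel_Ico) (simp add: s_def t_def add_divide_distrib)
    also have "t - s = 2 powi (- int l)"
      by (simp add: s_def t_def half_powi add_divide_distrib power_one_over)
    finally show "emeasure M (qball a (int l)) = ennreal (2 powi (- int l))" .
  qed
  then show ?thesis ..
qed

definition haar2 :: "q2 measure" where
  "haar2 = (THE M. normalized_haar2 M)"

lemma normalized_haar2_haar2: "normalized_haar2 haar2"
proof -
  have "\<exists>!M. normalized_haar2 M"
    using normalized_haar2_exists normalized_haar2_unique by blast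
  then show ?thesis unfolding haar2_def by (rule theI')
qed


section \<open>The space \<open>\<real> \<times> \<rat>\<^sub>2\<close> and the tiles\<close>

type_synonym K = "real \<times> q2"

definition kdist :: "K \<Rightarrow> K \<Rightarrow> real" where
  "kdist x y = max \<bar>fst x - fst y\<bar> (q2_abs (snd x - snd y))"

text \<open>The library equips products with the (equivalent) Euclidean combination of the two metrics.\<close>

lemma tendsto_kdist_iff:
  fixes f :: "'a \<Rightarrow> K"
  shows "(f \<longlongrightarrow> x) F \<longleftrightarrow> ((\<lambda>n. kdist (f n) x) \<longlongrightarrow> 0) F"
proof
  assume "(f \<longlongrightarrow> x) F"
  then have "((\<lambda>n. dist (fst (f n)) (fst x)) \<longlongrightarrow> 0) F" "((\<lambda>n. dist (snd (f n)) (snd x)) \<longlongrightarrow> 0) F"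
    by (simp_all flip: tendsto_dist_iff add: tendsto_fst tendsto_snd)
  from tendsto_max[OF this] show "((\<lambda>n. kdist (f n) x) \<longlongrightarrow> 0) F"
    by (simp add: kdist_def dist_real_def dist_q2_def)
next
  assume *: "((\<lambda>n. kdist (f n) x) \<longlongrightarrow> 0) F"
  have "((\<lambda>n. dist (fst (f n)) (fst x)) \<longlongrightarrow> 0) F"
    by (rule Lim_null_comparison[OF _ *]) (simp add: kdist_def dist_real_def)
  moreover have "((\<lambda>n. dist (snd (f n)) (snd x)) \<longlongrightarrow> 0) F"
    by (rule Lim_null_comparison[OF _ *]) (simp add: kdist_def dist_q2_def)
  ultimately have "((\<lambda>n. (fst (f n), snd (f n))) \<longlongrightarrow> (fst x, snd x)) F"
    by (intro tendsto_Pair) (simp_all add: tendsto_dist_iff[symmetric])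
  then show "(f \<longlongrightarrow> x) F" by simp
qed

lemma sums_kdist_iff:
  fixes f :: "nat \<Rightarrow> K"
  shows "f sums s \<longleftrightarrow> (\<lambda>n. kdist (\<Sum>i<n. f i) s) \<longlonglongrightarrow> 0"
  unfolding sums_def by (rule tendsto_kdist_iff)

definition kscale :: "rat \<Rightarrow> K \<Rightarrow> K" where
  "kscale \<alpha> x = (of_rat \<alpha> * fst x, of_rat \<alpha> * snd x)"

definition phi :: "rat \<Rightarrow> K" where
  "phi z = (of_rat z, of_rat z)"

definition dyadic :: "rat set" where
  "dyadic = {of_int a / 2 ^ l | a l. True}"

definition mu :: "K measure" where
  "mu = lborel \<Otimes>\<^sub>M haar2"

text \<open>The digit with index \<open>-i\<close> is \<open>d i\<close>; the library series starts at index \<open>0\<close>, hence the shift.\<close>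

definition tile :: "K set" where
  "tile = {kscale (1 / 2) s | s d. (\<forall>i\<ge>1. d i \<in> {0, 1, 2}) \<and>
     (\<lambda>n. kscale ((- (3 / 2)) powi (- int (n + 1))) (phi (d (n + 1)))) sums s}"

definition translate :: "K \<Rightarrow> K set \<Rightarrow> K set" where
  "translate v A = (\<lambda>x. x + v) ` A"

definition tiles :: "K set set" where
  "tiles = {translate (phi z) tile | z. z \<in> dyadic}"

end

theory Submission
  imports Defs
begin

text \<open>Write \<open>\<alpha> = -3/2\<close> and \<open>F\<close> for the tile. Multiplication by \<open>\<alpha>\<close> expands both factors, and
  \<open>\<alpha>F\<close> is the union of \<open>F + \<phi>(d/2)\<close> for \<open>d = 0, 1, 2\<close>. Conversely \<open>F\<close> contains every bounded set \<open>G\<close> such that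
  \<open>\<alpha>G\<close> lies in the union of the \<open>G + \<phi>(d/2)\<close>, because iterating produces the digits. The closure of \<open>F\<close> is such a
  set, so \<open>F\<close> is closed and no compactness argument is needed.

  Covering: the union \<open>U\<close> of the translates is closed by local finiteness and mapped into itself by \<open>\<alpha>\<^sup>-\<^sup>1\<close>. It contains
  \<open>\<phi>(\<int>[1/2])\<close>, which comes within distance \<open>1\<close> of every point; contracting, \<open>U\<close> is dense.

  Overlaps: multiplication by \<open>\<alpha>\<close> scales \<open>\<mu>\<close> by \<open>3/2 \<cdot> 2 = 3\<close>, so the three pieces of \<open>\<alpha>F\<close>, each of measure
  \<open>\<mu>(F) < \<infinity>\<close>, overlap in null sets. Every \<open>z\<close> in \<open>\<int>[1/2]\<close> has a finite expansion with base \<open>\<alpha>\<close> and digits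
  \<open>d/2\<close>, and induction on its length carries this over to all pairs of translates.\<close>

section \<open>Rational scaling, the diagonal embedding and 2-adic sizes\<close>

lemma kscale_add: "kscale a (x + y) = kscale a x + kscale a y"
  by (simp add: kscale_def prod_eq_iff distrib_left)

lemma kscale_diff: "kscale a (x - y) = kscale a x - kscale a y"
  by (simp add: kscale_def prod_eq_iff right_diff_distrib)

lemma kscale_0 [simp]: "kscale a 0 = 0"
  by (simp add: kscale_def prod_eq_iff)

lemma kscale_1 [simp]: "kscale 1 x = x"
  by (simp add: kscale_def)

lemma kscale_kscale: "kscale a (kscale b x) = kscale (a * b) x"
  by (simp add: kscale_def of_rat_mult mult.assoc)

lemma kscale_phi: "kscale a (phi z) = phi (a * z)"
  by (simp add: kscale_def phi_def of_rat_mult)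

lemma kscale_sum: "kscale a (sum f A) = (\<Sum>i\<in>A. kscale a (f i))"
  by (induct A rule: infinite_finite_induct) (simp_all add: kscale_add)

lemma phi_add: "phi (z + w) = phi z + phi w"
  by (simp add: phi_def of_rat_add)

lemma phi_0 [simp]: "phi 0 = 0"
  by (simp add: phi_def prod_eq_iff)

lemma phi_sum: "phi (sum f A) = (\<Sum>i\<in>A. phi (f i))"
  by (induct A rule: infinite_finite_induct) (simp_all add: phi_add)

lemma tendsto_mult_left_q2:
  fixes f :: "'a \<Rightarrow> q2"
  assumes "(f \<longlongrightarrow> l) F" shows "((\<lambda>n. c * f n) \<longlongrightarrow> c * l) F"
proof -
  have "dist (c * f n) (c * l) = q2_abs c * dist (f n) l" for n
    by (simp add: dist_q2_def flip: q2_abs_mult right_diff_distrib)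
  moreover have "((\<lambda>n. q2_abs c * dist (f n) l) \<longlongrightarrow> q2_abs c * 0) F"
    using assms by (intro tendsto_mult tendsto_const) (simp add: tendsto_dist_iff[symmetric])
  ultimately show ?thesis by (subst tendsto_dist_iff) simp
qed

lemma tendsto_kaffine:
  assumes "(f \<longlongrightarrow> l) F"
  shows "((\<lambda>n. kscale a (f n) + v) \<longlongrightarrow> kscale a l + v) F"
proof -
  have "((\<lambda>n. (of_rat a * fst (f n) + fst v, of_rat a * snd (f n) + snd v)) \<longlongrightarrow>
      (of_rat a * fst l + fst v, of_rat a * snd l + snd v)) F"
    using assms by (intro tendsto_Pair tendsto_add tendsto_const tendsto_mult_left_q2 tendsto_mult tendsto_fst tendsto_snd)
  then show ?thesis by (simp add: kscale_def plus_prod_def)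
qed

lemma continuous_on_kaffine: "continuous_on A (\<lambda>x. kscale a x + v)"
  unfolding continuous_on_def by (intro ballI tendsto_kaffine tendsto_ident_at)

lemma closed_kaffine_vimage: "closed S \<Longrightarrow> closed {x. kscale a x + v \<in> S}"
  using continuous_on_closed_vimage[of UNIV "\<lambda>x. kscale a x + v"] continuous_on_kaffine[of UNIV a v]
  by (simp add: vimage_def)

text \<open>As 3 is a 2-adic unit, only the power of 2 counts. Multiplication by \<open>-2/3\<close>
  thus contracts the real factor by 2/3 and the 2-adic factor by 1/2.\<close>

lemma abs2_fractions: "abs2 (2/3) = 1/2" "abs2 (3/2) = 2" "abs2 (1/2) = 2"
proof -
  have 3: "abs2 3 = 1"
    using abs2_frac[of 3 1] by (simp add: not_dvd_imp_multiplicity_0)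
  have "abs2 p / abs2 q = abs2 (p / q)" for p q
    unfolding divide_inverse abs2_mult abs2_inverse ..
  from this[of 2 3] this[of 3 2] this[of 1 2]
  show "abs2 (2/3) = 1/2" "abs2 (3/2) = 2" "abs2 (1/2) = 2"
    unfolding 3 abs2_2 abs2_1 by simp_all
qed

lemma abs2_power: "abs2 (q ^ n) = abs2 q ^ n"
  by (induct n) (simp_all add: abs2_mult)

lemma abs2_of_int_le_1: "abs2 (of_int a) \<le> 1"
  using abs2_of_int_le_iff[of a 0] by simp

lemma abs2_digit_le_1: "d \<in> {0, 1, 2} \<Longrightarrow> abs2 d \<le> 1"
  by (auto simp: abs2_2)

section \<open>The tile as a greatest invariant set\<close>

text \<open>A working form of the series: powers of \<open>-2/3\<close>, digits counted from 0, and
  the factor 1/2 moved to the other side as \<open>kscale 2 x\<close>. Every partial sum is then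
  \<open>phi\<close> of a rational.\<close>

lemma tile_iff:
  "x \<in> tile \<longleftrightarrow> (\<exists>e. (\<forall>i. e i \<in> {0, 1, 2}) \<and> (\<lambda>n. phi ((- (2 / 3)) ^ (n + 1) * e n)) sums kscale 2 x)"
proof -
  have p: "(- (3 / 2)) powi (- int (n + 1)) = (- (2 / 3) :: rat) ^ (n + 1)" for n
    by (simp only: power_int_minus power_int_of_nat flip: power_inverse) simp
  show ?thesis
  proof
    assume "x \<in> tile"
    then obtain s d where d: "\<forall>i\<ge>1. d i \<in> {0, 1, 2}" and x: "x = kscale (1/2) s"
      and s: "(\<lambda>n. kscale ((- (3 / 2)) powi (- int (n + 1))) (phi (d (n + 1)))) sums s"
      by (auto simp: tile_def)
    from s have "(\<lambda>n. phi ((- (2 / 3)) ^ (n + 1) * d (n + 1))) sums kscale 2 x"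
      unfolding p kscale_phi x kscale_kscale by simp
    with d show "\<exists>e. (\<forall>i. e i \<in> {0, 1, 2}) \<and> (\<lambda>n. phi ((- (2 / 3)) ^ (n + 1) * e n)) sums kscale 2 x"
      by (intro exI[of _ "\<lambda>n. d (n + 1)"]) simp
  next
    assume "\<exists>e. (\<forall>i. e i \<in> {0, 1, 2}) \<and> (\<lambda>n. phi ((- (2 / 3)) ^ (n + 1) * e n)) sums kscale 2 x"
    then obtain e where "\<forall>i. e i \<in> {0, 1, 2}" "(\<lambda>n. phi ((- (2 / 3)) ^ (n + 1) * e n)) sums kscale 2 x"
      by blast
    then show "x \<in> tile"
      unfolding tile_def p kscale_phi
      by (intro CollectI exI[of _ "kscale 2 x"] exI[of _ "\<lambda>n. e (n - 1)"]) (auto simp: kscale_kscale)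
  qed
qed

text \<open>The bounds come from estimating the series termwise:
  \<open>1/2 * (4/3) / (1 - 2/3) = 2\<close> in the real factor and \<open>2 * 1/2 = 1\<close> in
  the 2-adic factor.\<close>

definition tile_box :: "K set" where
  "tile_box = {-2..2} \<times> qball 0 0"

lemma in_tile_box_iff: "x \<in> tile_box \<longleftrightarrow> \<bar>fst x\<bar> \<le> 2 \<and> q2_abs (snd x) \<le> 1"
  by (cases x) (auto simp: tile_box_def qball_def)

lemma closed_tile_box: "closed tile_box"
  unfolding tile_box_def qball_cball by (intro closed_Times closed_cball closed_atLeastAtMost)

lemma tile_subset_tile_box: "tile \<subseteq> tile_box"
proof
  fix x assume "x \<in> tile"
  then obtain e where e: "\<And>i. e i \<in> {0, 1, 2}"
    and s: "(\<lambda>n. phi ((- (2 / 3)) ^ (n + 1) * e n)) sums kscale 2 x"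
    unfolding tile_iff by blast
  define S where "S n = (\<Sum>i<n. (- (2 / 3)) ^ (i + 1) * e i)" for n
  have lim: "(\<lambda>n. phi (S n)) \<longlonglongrightarrow> kscale 2 x"
    using s unfolding sums_def S_def phi_sum .
  \<comment> \<open>The right side is the exact geometric sum of \<open>2 * (2/3)^i\<close> for
    \<open>i\<close> from 1 to \<open>n\<close>.\<close>
  have real: "\<bar>S n\<bar> \<le> 4 - 4 * (2 / 3) ^ n" for n
  proof (induct n)
    case (Suc n)
    have "\<bar>(- (2 / 3)) ^ (n + 1) * e n\<bar> = (2 / 3) ^ (n + 1) * \<bar>e n\<bar>"
      by (simp add: abs_mult power_abs)
    also have "\<dots> \<le> (2 / 3) ^ (n + 1) * 2"
      using e[of n] by (intro mult_left_mono) auto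
    finally have "\<bar>(- (2 / 3)) ^ (n + 1) * e n\<bar> \<le> (2 / 3) ^ (n + 1) * 2" .
    moreover have "S (Suc n) = S n + (- (2 / 3)) ^ (n + 1) * e n" by (simp add: S_def)
    ultimately show ?case using Suc by simp
  qed (simp add: S_def)
  \<comment> \<open>Each term has 2-adic size at most 1/2, hence by the ultrametric inequality so
    has each sum.\<close>
  have dyadic: "abs2 (S n) \<le> 1 / 2" for n
  proof (induct n)
    case (Suc n)
    have "abs2 ((- (2 / 3)) ^ (n + 1) * e n) = (1 / 2) ^ (n + 1) * abs2 (e n)"
      by (simp only: abs2_mult abs2_power abs2_minus abs2_fractions)
    also have "\<dots> \<le> (1 / 2) ^ 1 * 1"
      using abs2_digit_le_1[OF e[of n]] by (intro mult_mono power_decreasing) auto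
    finally have "max (abs2 (S n)) (abs2 ((- (2 / 3)) ^ (n + 1) * e n)) \<le> 1 / 2" using Suc by simp
    moreover have "S (Suc n) = S n + (- (2 / 3)) ^ (n + 1) * e n" by (simp add: S_def)
    ultimately show ?case by (simp only: order_trans[OF abs2_add])
  qed (simp add: S_def)
  have "fst (phi (S n)) \<in> {-4..4}" for n
  proof -
    have "\<bar>S n\<bar> \<le> 4" using real[of n] by (rule order_trans) simp
    then have "of_rat (S n) \<le> (of_rat 4 :: real)" "of_rat (- S n) \<le> (of_rat 4 :: real)"
      unfolding of_rat_less_eq by linarith+
    then show ?thesis by (simp add: phi_def of_rat_minus)
  qed
  then have "fst (kscale 2 x) \<in> {-4..4}"
    by (rule closed_sequentially[OF closed_atLeastAtMost _ tendsto_fst[OF lim]])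
  have "snd (kscale 2 x) \<in> qball 0 1"
  proof (rule closed_sequentially[OF _ _ tendsto_snd[OF lim]])
    show "snd (phi (S n)) \<in> qball 0 1" for n
      using dyadic[of n] by (simp add: qball_def phi_def power_int_minus)
  qed (simp add: qball_cball)
  then have "q2_abs 2 * q2_abs (snd x) \<le> 1 / 2"
    by (simp add: kscale_def qball_def power_int_minus q2_abs_mult)
  then have "q2_abs (snd x) \<le> 1" unfolding q2_abs_2 by linarith
  moreover have "\<bar>fst x\<bar> \<le> 2"
    using \<open>fst (kscale 2 x) \<in> {-4..4}\<close> by (auto simp: kscale_def)
  ultimately show "x \<in> tile_box" by (simp only: in_tile_box_iff simp_thms)
qed

text \<open>Multiplying the series by \<open>-3/2\<close> shifts the digits by one place: the first
  digit splits off as \<open>phi (d / 2)\<close>, and the others again describe a point of the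
  tile.\<close>

lemma tile_step:
  assumes "x \<in> tile"
  shows "\<exists>d\<in>{0, 1, 2}. kscale (- (3 / 2)) x - phi (d / 2) \<in> tile"
proof -
  obtain e where e: "\<And>i. e i \<in> {0, 1, 2}"
    and s: "(\<lambda>n. phi ((- (2 / 3)) ^ (n + 1) * e n)) sums kscale 2 x"
    using assms unfolding tile_iff by blast
  let ?y = "kscale (- (3 / 2)) x - phi (e 0 / 2)"
  have *: "kscale (- (3 / 2)) (phi ((- (2 / 3)) ^ Suc i * c)) = phi ((- (2 / 3)) ^ i * c)" for i c
  proof -
    have "- (3 / 2) * ((- (2 / 3)) ^ Suc i * c) = (- (2 / 3)) ^ i * c"
      unfolding power_Suc mult.assoc[symmetric] by simp
    then show ?thesis by (simp only: kscale_phi)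
  qed
  have shift: "kscale (- (3 / 2)) (\<Sum>i<Suc n. phi ((- (2 / 3)) ^ (i + 1) * e i)) + - phi (e 0) =
      (\<Sum>i<n. phi ((- (2 / 3)) ^ (i + 1) * e (Suc i)))" for n
    unfolding sum.lessThan_Suc_shift kscale_add kscale_sum Suc_eq_plus1[symmetric] * by simp
  have y: "kscale (- (3 / 2)) (kscale 2 x) + - phi (e 0) = kscale 2 ?y"
    by (simp add: kscale_diff kscale_kscale kscale_phi)
  have "(\<lambda>n. \<Sum>i<Suc n. phi ((- (2 / 3)) ^ (i + 1) * e i)) \<longlonglongrightarrow> kscale 2 x"
    using s unfolding sums_def by (rule LIMSEQ_Suc)
  from tendsto_kaffine[OF this, of "- (3 / 2)" "- phi (e 0)"]
  have "(\<lambda>n. phi ((- (2 / 3)) ^ (n + 1) * e (Suc n))) sums kscale 2 ?y"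
    unfolding shift y sums_def .
  then have "?y \<in> tile"
    unfolding tile_iff using e by (intro exI[of _ "\<lambda>i. e (Suc i)"] conjI allI)
  then show ?thesis using e[of 0] by (rule bexI)
qed

text \<open>A coinduction principle. Iterating the step yields digits of \<open>x\<close>; after
  \<open>n\<close> of them the remainder is \<open>(-2/3)^n\<close> times a point of the box, which
  tends to 0.\<close>

lemma tile_greatest:
  assumes box: "G \<subseteq> tile_box"
    and step: "\<And>x. x \<in> G \<Longrightarrow> \<exists>d\<in>{0, 1, 2}. kscale (- (3 / 2)) x - phi (d / 2) \<in> G"
  shows "G \<subseteq> tile"
proof
  fix x assume x: "x \<in> G"
  \<comment> \<open>Fixing one admissible digit per point turns the step into a function. Its orbit
    is \<open>X\<close>, and \<open>D (X i)\<close> becomes the digit at place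
    \<open>i + 1\<close>.\<close>
  obtain D where D: "\<And>x. x \<in> G \<Longrightarrow> D x \<in> {0, 1, 2} \<and> kscale (- (3 / 2)) x - phi (D x / 2) \<in> G"
    using step by metis
  define X where "X n = ((\<lambda>x. kscale (- (3 / 2)) x - phi (D x / 2)) ^^ n) x" for n
  have X0: "X 0 = x" and XSuc: "\<And>n. X (Suc n) = kscale (- (3 / 2)) (X n) - phi (D (X n) / 2)"
    by (simp_all add: X_def)
  have XG: "X n \<in> G" for n by (induct n) (use x D in \<open>simp_all add: X0 XSuc\<close>)
  let ?r = "- (2 / 3) :: rat"
  \<comment> \<open>Telescoping: the partial sums miss \<open>kscale 2 x\<close> by exactly the
    rescaled orbit point.\<close>
  have S: "(\<Sum>i<n. phi (?r ^ (i + 1) * D (X i))) = kscale 2 x - kscale (2 * ?r ^ n) (X n)" for n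
  proof (induct n)
    case (Suc n)
    have "2 * ?r ^ Suc n * - (3 / 2) = 2 * ?r ^ n" "2 * ?r ^ Suc n * (D (X n) / 2) = ?r ^ (n + 1) * D (X n)"
      by simp_all
    with Suc show ?case by (simp only: sum.lessThan_Suc XSuc kscale_diff kscale_kscale kscale_phi) simp
  qed (simp add: X0)
  have "(\<lambda>n. kdist (\<Sum>i<n. phi (?r ^ (i + 1) * D (X i))) (kscale 2 x)) \<longlonglongrightarrow> 0"
  proof (rule Lim_null_comparison)
    have ab: "\<bar>of_rat (?r ^ n)\<bar> = (2 / 3 :: real) ^ n" "abs2 (?r ^ n) = (1 / 2) ^ n" for n
      by (simp_all only: of_rat_power power_abs abs2_power abs2_minus abs2_fractions) (simp add: of_rat_minus of_rat_divide)
    \<comment> \<open>The 4 is the factor 2 of \<open>kscale 2\<close> times the real bound 2 of the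
      box; the 2-adic remainder, at most \<open>(1/2)^(n+1)\<close>, obeys the same bound.\<close>
    have "kdist (\<Sum>i<n. phi (?r ^ (i + 1) * D (X i))) (kscale 2 x) \<le> 4 * (2 / 3) ^ n" for n
    proof -
      have b: "\<bar>fst (X n)\<bar> \<le> 2" "q2_abs (snd (X n)) \<le> 1" using XG[of n] box by (auto simp: in_tile_box_iff)
      have 1: "\<bar>of_rat (2 * ?r ^ n) * fst (X n)\<bar> \<le> 4 * (2 / 3) ^ n"
        using mult_left_mono[OF b(1), of "2 * (2 / 3) ^ n"] by (simp only: of_rat_mult abs_mult ab) simp
      have "q2_abs (of_rat (2 * ?r ^ n) * snd (X n)) = 1 / 2 * (1 / 2) ^ n * q2_abs (snd (X n))"
        by (simp only: q2_abs_mult q2_abs_of_rat abs2_mult ab abs2_2)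
      also have "\<dots> \<le> 4 * (2 / 3) ^ n * 1"
        using b(2) by (intro mult_mono power_mono) auto
      finally have 2: "q2_abs (of_rat (2 * ?r ^ n) * snd (X n)) \<le> 4 * (2 / 3) ^ n" by simp
      show ?thesis unfolding S kdist_def using 1 2 by (simp add: kscale_def)
    qed
    then show "\<forall>\<^sub>F n in sequentially. norm (kdist (\<Sum>i<n. phi (?r ^ (i + 1) * D (X i))) (kscale 2 x)) \<le> 4 * (2 / 3) ^ n"
      by (simp add: kdist_def)
    show "(\<lambda>n. 4 * (2 / 3 :: real) ^ n) \<longlonglongrightarrow> 0"
      by (intro tendsto_mult_right_zero LIMSEQ_power_zero) simp
  qed
  moreover have "D (X n) \<in> {0, 1, 2}" for n using D[OF XG] by (rule conjunct1)
  ultimately show "x \<in> tile"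
    unfolding tile_iff sums_kdist_iff by (intro exI[of _ "\<lambda>n. D (X n)"] conjI allI)
qed

text \<open>The step with digit 0 fixes 0.\<close>

lemma zero_in_tile: "0 \<in> tile"
proof -
  have "{0} \<subseteq> tile"
    by (rule tile_greatest) (auto simp: in_tile_box_iff)
  then show ?thesis by simp
qed

text \<open>Adjoining \<open>x\<close> to the tile preserves the step property, so
  \<open>tile_greatest\<close> applies once \<open>x\<close> is known to lie in the box.\<close>

lemma tile_unstep:
  assumes y: "kscale (- (3 / 2)) x - phi (d / 2) \<in> tile" and d: "d \<in> {0, 1, 2}"
  shows "x \<in> tile"
proof -
  \<comment> \<open>Real factor: the bound is \<open>2/3 * (2 + 1) = 2\<close>. 2-adic factor:
    \<open>-3/2\<close> times the component has size at most \<open>max 1 2 = 2\<close>, and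
    \<open>-3/2\<close> itself has size 2.\<close>
  have "x \<in> tile_box"
  proof -
    have b: "\<bar>of_rat (- (3 / 2)) * fst x - of_rat (d / 2)\<bar> \<le> 2"
      "q2_abs (of_rat (- (3 / 2)) * snd x - of_rat (d / 2)) \<le> 1"
      using subsetD[OF tile_subset_tile_box y] by (simp_all add: in_tile_box_iff kscale_def phi_def)
    have "\<bar>fst x\<bar> \<le> 2"
      using b(1) d by (auto simp: of_rat_minus of_rat_divide abs_le_iff)
    moreover have "q2_abs (of_rat (- (3 / 2)) * snd x) \<le> 2"
    proof -
      have "abs2 (d / 2) \<le> 2" using abs2_mult[of d "1/2"] abs2_digit_le_1[OF d] by (simp add: abs2_fractions)
      moreover have "q2_abs (of_rat (- (3 / 2)) * snd x) \<le>
          max (q2_abs (of_rat (- (3 / 2)) * snd x - of_rat (d / 2))) (q2_abs (of_rat (d / 2)))"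
        using q2_abs_add[of "of_rat (- (3 / 2)) * snd x - of_rat (d / 2)" "of_rat (d / 2)"] by simp
      ultimately show ?thesis using b(2) by simp
    qed
    then have "q2_abs (snd x) \<le> 1" by (simp only: q2_abs_mult q2_abs_of_rat abs2_minus abs2_fractions)
    ultimately show ?thesis by (simp add: in_tile_box_iff)
  qed
  have "insert x tile \<subseteq> tile"
  proof (rule tile_greatest)
    show "insert x tile \<subseteq> tile_box" using \<open>x \<in> tile_box\<close> tile_subset_tile_box by simp
    fix z assume "z \<in> insert x tile"
    then consider "z = x" | "z \<in> tile" by blast
    then have "\<exists>d\<in>{0, 1, 2}. kscale (- (3 / 2)) z - phi (d / 2) \<in> tile"
    proof cases
      case 1
      then show ?thesis using y d by (intro bexI[of _ d]) simp_all
    qed (rule tile_step)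
    then show "\<exists>d\<in>{0, 1, 2}. kscale (- (3 / 2)) z - phi (d / 2) \<in> insert x tile" by auto
  qed
  then show ?thesis by simp
qed

lemma closed_tile: "closed tile"
proof -
  have "closure tile \<subseteq> tile"
  proof (rule tile_greatest)
    show "closure tile \<subseteq> tile_box" using tile_subset_tile_box closed_tile_box by (rule closure_minimal)
    \<comment> \<open>The points with some digit leading into the closure form a finite union of
      closed preimages. This set contains the tile, hence its closure.\<close>
    let ?C = "\<Union>d\<in>{0, 1, 2}. {x. kscale (- (3 / 2)) x + (- phi (d / 2)) \<in> closure tile}"
    have "closed ?C" by (intro closed_UN ballI closed_kaffine_vimage closed_closure finite.intros)
    moreover have "tile \<subseteq> ?C"
    proof
      fix x assume "x \<in> tile"
      then obtain d where "d \<in> {0, 1, 2}" "kscale (- (3 / 2)) x - phi (d / 2) \<in> tile"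
        using tile_step by blast
      then show "x \<in> ?C" using subsetD[OF closure_subset, of _ tile] by (intro UN_I[of d]) simp_all
    qed
    ultimately have "closure tile \<subseteq> ?C" by (simp only: closure_minimal)
    then show "\<exists>d\<in>{0, 1, 2}. kscale (- (3 / 2)) x - phi (d / 2) \<in> closure tile" if "x \<in> closure tile" for x
      using that by auto
  qed
  then show ?thesis using closure_subset_eq by blast
qed

lemma in_translate_iff: "x \<in> translate v A \<longleftrightarrow> x - v \<in> A"
  unfolding translate_def by (auto intro!: image_eqI[of x _ "x - v"])

lemma closed_translate_tile: "closed (translate v tile)"
  using closed_kaffine_vimage[OF closed_tile, of 1 "- v"] by (simp add: in_translate_iff[symmetric])

section \<open>Covering\<close>

text \<open>Division with remainder in base \<open>-3/2\<close>: since \<open>2 ^ l\<close> is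
  invertible modulo 3, some \<open>a - d * 2 ^ l\<close> is divisible by 3. The denominator loses
  one factor 2.\<close>

lemma dyadic_digit:
  "\<exists>d\<in>{0, 1, 2}. \<exists>b. of_int a / 2 ^ Suc l = (d / 2 + - (3 / 2) * (of_int b / 2 ^ l) :: rat)"
proof -
  have "(2::int) ^ l mod 3 \<noteq> 0"
  proof
    assume "(2::int) ^ l mod 3 = 0"
    then have "(3::int) dvd 2 ^ l" by auto
    then have "(3::int) dvd 2" using prime_dvd_power[of "3::int" 2 l] by simp
    then show False by simp
  qed
  then have "3 dvd a \<or> 3 dvd a - 2 ^ l \<or> 3 dvd a - 2 * 2 ^ l"
    by presburger
  then obtain d :: int where d: "d \<in> {0, 1, 2}" "3 dvd a - d * 2 ^ l"
    by (metis insertCI mult_1 mult_zero_left diff_zero)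
  from d(2) obtain b where b: "a - d * 2 ^ l = 3 * b" by (rule dvdE)
  have "of_int (a - d * 2 ^ l) = (of_int (3 * b) :: rat)" using b by simp
  then have "of_int a / 2 ^ Suc l = (of_int d / 2 + - (3 / 2) * (of_int (- b) / 2 ^ l) :: rat)"
    by (simp add: field_simps)
  moreover have "(of_int d :: rat) \<in> {0, 1, 2}" using d(1) by auto
  ultimately show ?thesis by blast
qed

lemma dyadic_step:
  assumes "z \<in> dyadic"
  shows "\<exists>d\<in>{0, 1, 2}. \<exists>w\<in>dyadic. z = d / 2 + - (3 / 2) * w"
proof -
  obtain a l where z: "z = of_int a / 2 ^ l" using assms by (auto simp: dyadic_def)
  then have "z = of_int (2 * a) / 2 ^ Suc l" by simp
  then show ?thesis using dyadic_digit[of "2 * a" l] unfolding dyadic_def by blast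
qed

lemma of_int_dyadic: "of_int a \<in> dyadic"
  unfolding dyadic_def by (intro CollectI exI[of _ a] exI[of _ 0]) simp

text \<open>A dyadic rational that is also a 2-adic integer is an integer; this is applied to
  \<open>2 ^ m * z\<close>.\<close>

lemma dyadic_integral:
  assumes "z \<in> dyadic" "abs2 (2 ^ m * z) \<le> 1" shows "\<exists>b. z = of_int b / 2 ^ m"
proof -
  obtain a l where z: "z = of_int a / 2 ^ l" using assms by (auto simp: dyadic_def)
  have "abs2 (2 ^ l * (2 ^ m * z)) = (1 / 2) ^ l * abs2 (2 ^ m * z)"
    by (simp only: abs2_mult abs2_power abs2_2)
  also have "\<dots> \<le> (1 / 2) ^ l" using assms(2) by (simp add: mult_left_le)
  also have "2 ^ l * (2 ^ m * z) = of_int (2 ^ m * a)" by (simp add: z)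
  finally have "2 ^ l dvd 2 ^ m * a" by (simp only: half_powi flip: abs2_of_int_le_iff)
  then obtain b where "2 ^ m * a = 2 ^ l * b" by (rule dvdE)
  then have "(of_int (2 ^ m * a) :: rat) = of_int (2 ^ l * b)" by (simp only:)
  then have "z = of_int b / 2 ^ m" by (simp add: z field_simps)
  then show ?thesis ..
qed

text \<open>The image of \<open>dyadic\<close> under \<open>phi\<close> is discrete: the 2-adic
  bound limits the denominator, and then the real bound limits the numerator.\<close>

lemma finite_bounded_dyadic:
  "finite {z \<in> dyadic. \<bar>z\<bar> \<le> r \<and> abs2 z \<le> c}"
proof -
  obtain m where m: "c \<le> 2 ^ m" using real_arch_pow[of 2 c] by (auto intro: less_imp_le)
  define N where "N = \<lceil>2 ^ m * r\<rceil>"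
  have "z \<in> (\<lambda>b. of_int b / 2 ^ m) ` {- N..N}" if z: "z \<in> dyadic" "\<bar>z\<bar> \<le> r" "abs2 z \<le> c" for z
  proof -
    have "(1 / 2) ^ m * abs2 z \<le> (1 / 2) ^ m * 2 ^ m" using z(3) m by (intro mult_left_mono) auto
    then have "abs2 (2 ^ m * z) \<le> 1" by (simp add: abs2_mult abs2_power abs2_2 flip: power_mult_distrib)
    then obtain b where b: "z = of_int b / 2 ^ m" using dyadic_integral z(1) by blast
    then have "of_int \<bar>b\<bar> = 2 ^ m * \<bar>z\<bar>" by simp
    also have "\<dots> \<le> 2 ^ m * r" using z(2) by (intro mult_left_mono) auto
    also have "\<dots> \<le> of_int N" unfolding N_def by (rule le_of_int_ceiling)
    finally have "\<bar>b\<bar> \<le> N" by (simp only: of_int_le_iff)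
    then show ?thesis using b by (intro image_eqI[of _ _ b]) (auto simp: abs_le_iff)
  qed
  then have "{z \<in> dyadic. \<bar>z\<bar> \<le> r \<and> abs2 z \<le> c} \<subseteq> (\<lambda>b. of_int b / 2 ^ m) ` {- N..N}" by blast
  then show ?thesis by (rule finite_subset) simp
qed

lemma dyadic_add: "z \<in> dyadic \<Longrightarrow> w \<in> dyadic \<Longrightarrow> z + w \<in> dyadic"
proof -
  assume "z \<in> dyadic" "w \<in> dyadic"
  then obtain a k b l where "z = of_int a / 2 ^ k" "w = of_int b / 2 ^ l" by (auto simp: dyadic_def)
  then have "z + w = of_int (a * 2 ^ l + b * 2 ^ k) / 2 ^ (k + l)"
    by (simp add: power_add add_divide_distrib)
  then show "z + w \<in> dyadic" unfolding dyadic_def by blast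
qed

text \<open>Scale \<open>y\<close> into \<open>Z2\<close> by \<open>2 ^ m\<close>, approximate by an
  integer with precision \<open>2 ^ (-m)\<close>, and scale back.\<close>

lemma dyadic_approx_q2: "\<exists>z\<in>dyadic. q2_abs (y - of_rat z) \<le> 1"
proof -
  obtain m where m: "q2_abs y \<le> 2 ^ m" using real_arch_pow[of 2 "q2_abs y"] by (auto intro: less_imp_le)
  have "q2_abs (2 ^ m) = (1 / 2) ^ m"
    using q2_abs_of_rat[of "2 ^ m"] by (simp add: abs2_power abs2_2 of_rat_power)
  then have p: "q2_abs (2 ^ m * u) = (1 / 2) ^ m * q2_abs u" for u by (simp add: q2_abs_mult)
  have "(1 / 2) ^ m * q2_abs y \<le> (1 / 2) ^ m * 2 ^ m" using m by (intro mult_left_mono) auto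
  then have "q2_abs (2 ^ m * y) \<le> 1" unfolding p by (simp flip: power_mult_distrib)
  then obtain k where k: "q2_abs (2 ^ m * y - of_int k) \<le> 2 powi (- int m)"
    using Z2_int_approx by blast
  let ?z = "of_int k / 2 ^ m :: rat"
  have "2 ^ m * y - of_int k = 2 ^ m * (y - of_rat ?z)"
    by (simp add: of_rat_divide of_rat_power right_diff_distrib)
  then have "(1 / 2) ^ m * q2_abs (y - of_rat ?z) \<le> (1 / 2) ^ m" using k unfolding half_powi by (simp only: p)
  then have "q2_abs (y - of_rat ?z) \<le> 1" by simp
  moreover have "?z \<in> dyadic" unfolding dyadic_def by blast
  ultimately show ?thesis by blast
qed

text \<open>After the 2-adic component is approximated, an integer shift repairs the real component;
  integers have 2-adic size at most 1, so the first approximation survives.\<close>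

lemma dyadic_approx: "\<exists>z\<in>dyadic. kdist x (phi z) \<le> 1"
proof -
  obtain w where w: "w \<in> dyadic" "q2_abs (snd x - of_rat w) \<le> 1" using dyadic_approx_q2 by blast
  define n where "n = \<lfloor>fst x - of_rat w\<rfloor>"
  have "\<bar>fst x - of_rat (w + of_int n)\<bar> \<le> 1"
    using of_int_floor_le[of "fst x - of_rat w"] real_of_int_floor_add_one_gt[of "fst x - of_rat w"]
    unfolding n_def of_rat_add of_rat_of_int_eq by linarith
  moreover have "q2_abs (snd x - of_rat (w + of_int n)) \<le> 1"
  proof -
    have "snd x - of_rat (w + of_int n) = (snd x - of_rat w) - of_rat (of_int n)" by (simp add: of_rat_add)
    also have "q2_abs \<dots> \<le> max (q2_abs (snd x - of_rat w)) (abs2 (of_int n))"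
      using q2_abs_diff[of "snd x - of_rat w" "of_rat (of_int n)"] by (simp only: q2_abs_of_rat)
    also have "\<dots> \<le> 1" using w(2) abs2_of_int_le_1 by simp
    finally show ?thesis .
  qed
  ultimately have "kdist x (phi (w + of_int n)) \<le> 1" by (simp add: kdist_def phi_def)
  then show ?thesis using w(1) of_int_dyadic dyadic_add by blast
qed

section \<open>Density and closedness of the union of translates\<close>

lemma kdist_contract: "kdist (kscale (- (2 / 3)) x) (kscale (- (2 / 3)) y) \<le> 2 / 3 * kdist x y"
proof -
  have "of_rat (- (2 / 3)) * fst x - of_rat (- (2 / 3)) * fst y = - (2 / 3) * (fst x - fst y)"
    unfolding right_diff_distrib[symmetric] by (simp add: of_rat_minus of_rat_divide)
  then have 1: "\<bar>of_rat (- (2 / 3)) * fst x - of_rat (- (2 / 3)) * fst y\<bar> = 2 / 3 * \<bar>fst x - fst y\<bar>"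
    by (simp only: abs_mult)
  have "q2_abs (of_rat (- (2 / 3)) * snd x - of_rat (- (2 / 3)) * snd y) = 1 / 2 * q2_abs (snd x - snd y)"
    unfolding right_diff_distrib[symmetric] q2_abs_mult q2_abs_of_rat abs2_minus abs2_fractions ..
  also have "\<dots> \<le> 2 / 3 * q2_abs (snd x - snd y)" by (intro mult_right_mono) auto
  finally show ?thesis unfolding kdist_def kscale_def fst_conv snd_conv 1 by (auto simp: max_def)
qed

text \<open>With \<open>z = d / 2 - (3/2) * w\<close>, multiplication by \<open>-2/3\<close> sends
  the translate at \<open>z\<close> into the translate at \<open>w\<close>, by
  \<open>tile_unstep\<close> with digit \<open>d\<close>.\<close>

lemma translates_contract:
  assumes "x \<in> (\<Union>z\<in>dyadic. translate (phi z) tile)"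
  shows "kscale (- (2 / 3)) x \<in> (\<Union>z\<in>dyadic. translate (phi z) tile)"
proof -
  obtain z where z: "z \<in> dyadic" "x - phi z \<in> tile" using assms by (auto simp: in_translate_iff)
  obtain d w where d: "d \<in> {0, 1, 2}" and w: "w \<in> dyadic" and eq: "z = d / 2 + - (3 / 2) * w"
    using dyadic_step[OF z(1)] by blast
  have "kscale (- (3 / 2)) (kscale (- (2 / 3)) x - phi w) - phi (d / 2) = x - phi z"
    unfolding eq phi_add by (simp add: kscale_diff kscale_kscale kscale_phi)
  then have "kscale (- (2 / 3)) x - phi w \<in> tile" using z(2) d tile_unstep by metis
  then show ?thesis using w by (auto simp: in_translate_iff)
qed

text \<open>Only finitely many translates come within distance 1 of \<open>x\<close>, and a finite
  union of closed sets is closed.\<close>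

lemma translates_closed:
  assumes y: "\<And>n. y n \<in> (\<Union>z\<in>dyadic. translate (phi z) tile)" and lim: "y \<longlonglongrightarrow> x"
    and bound: "\<And>n :: nat. kdist (y n) x \<le> 1"
  shows "x \<in> (\<Union>z\<in>dyadic. translate (phi z) tile)"
proof -
  \<comment> \<open>The 3 is the real bound 2 of the box plus the distance 1 from \<open>y n\<close>
    to \<open>x\<close>.\<close>
  obtain k where k: "\<bar>fst x\<bar> + 3 \<le> real k" using real_arch_simple by blast
  define r :: rat where "r = of_nat k"
  have r: "\<bar>fst x\<bar> + 3 \<le> of_rat r" using k by (simp add: r_def)
  define Z where "Z = {z \<in> dyadic. \<bar>z\<bar> \<le> r \<and> abs2 z \<le> max 1 (q2_abs (snd x))}"
  have "y n \<in> (\<Union>z\<in>Z. translate (phi z) tile)" for n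
  proof -
    obtain z where z: "z \<in> dyadic" "y n - phi z \<in> tile" using y[of n] by (auto simp: in_translate_iff)
    have b: "\<bar>fst (y n) - of_rat z\<bar> \<le> 2" "q2_abs (snd (y n) - of_rat z) \<le> 1"
      using subsetD[OF tile_subset_tile_box z(2)] by (simp_all add: in_tile_box_iff phi_def)
    have c: "\<bar>fst (y n) - fst x\<bar> \<le> 1" "q2_abs (snd (y n) - snd x) \<le> 1"
      using bound[of n] by (simp_all add: kdist_def)
    have "\<bar>of_rat z\<bar> \<le> (of_rat r :: real)" using b(1) c(1) r by linarith
    then have "\<bar>z\<bar> \<le> r" by (simp only: abs_of_rat of_rat_less_eq)
    moreover have "abs2 z \<le> max 1 (q2_abs (snd x))"
    proof -
      have "q2_abs (of_rat z - snd x) \<le> 1"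
        using q2_abs_diff3[of "of_rat z" "snd x" "snd (y n)"] b(2) c(2)
        by (simp add: q2_abs_diff_commute[of "of_rat z"])
      then show ?thesis using q2_abs_add[of "of_rat z - snd x" "snd x"] by simp
    qed
    ultimately show ?thesis using z by (auto simp: Z_def in_translate_iff)
  qed
  moreover have "closed (\<Union>z\<in>Z. translate (phi z) tile)"
    unfolding Z_def by (intro closed_UN finite_bounded_dyadic ballI closed_translate_tile)
  ultimately have "x \<in> (\<Union>z\<in>Z. translate (phi z) tile)" using lim closed_sequentially by blast
  then show ?thesis by (auto simp: Z_def)
qed

lemma translates_cover: "(\<Union>z\<in>dyadic. translate (phi z) tile) = UNIV"
proof -
  have "x \<in> (\<Union>z\<in>dyadic. translate (phi z) tile)" for x
  proof -
    let ?f = "kscale (- (2 / 3))"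
    have "\<exists>y\<in>(\<Union>z\<in>dyadic. translate (phi z) tile). kdist y x \<le> (2 / 3) ^ n" for n
    proof (induct n arbitrary: x)
      case 0
      obtain z where z: "z \<in> dyadic" "kdist x (phi z) \<le> 1" using dyadic_approx by blast
      have "phi z \<in> (\<Union>z\<in>dyadic. translate (phi z) tile)"
        using z(1) zero_in_tile by (intro UN_I[of z]) (simp_all add: in_translate_iff)
      moreover have "kdist (phi z) x \<le> 1"
        using z(2) by (simp add: kdist_def abs_minus_commute q2_abs_diff_commute)
      ultimately show ?case by auto
    next
      \<comment> \<open>The hypothesis is used at \<open>-3/2\<close> times \<open>x\<close>;
        contracting the approximation found there gains a factor 2/3.\<close>
      case (Suc n)
      obtain y where y: "y \<in> (\<Union>z\<in>dyadic. translate (phi z) tile)" "kdist y (kscale (- (3 / 2)) x) \<le> (2 / 3) ^ n"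
        using Suc[of "kscale (- (3 / 2)) x"] by blast
      have "kdist (?f y) x \<le> 2 / 3 * kdist y (kscale (- (3 / 2)) x)"
        using kdist_contract[of y "kscale (- (3 / 2)) x"] by (simp add: kscale_kscale)
      also have "\<dots> \<le> (2 / 3) ^ Suc n" using y(2) by simp
      finally show ?case using translates_contract[OF y(1)] by blast
    qed
    then obtain y where y: "\<And>n. y n \<in> (\<Union>z\<in>dyadic. translate (phi z) tile)" "\<And>n. kdist (y n) x \<le> (2 / 3) ^ n"
      by metis
    have "(\<lambda>n. kdist (y n) x) \<longlonglongrightarrow> 0"
    proof (rule Lim_null_comparison)
      show "\<forall>\<^sub>F n in sequentially. norm (kdist (y n) x) \<le> (2 / 3) ^ n"
        using y(2) by (simp add: kdist_def)
      show "(\<lambda>n. (2 / 3 :: real) ^ n) \<longlonglongrightarrow> 0" by (intro LIMSEQ_power_zero) simp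
    qed
    then have lim: "y \<longlonglongrightarrow> x" by (simp only: tendsto_kdist_iff)
    have "kdist (y n) x \<le> 1" for n
      using y(2)[of n] power_le_one[of "2 / 3 :: real" n] by simp
    then show ?thesis by (rule translates_closed[OF y(1) lim])
  qed
  then show ?thesis by blast
qed

section \<open>Overlaps\<close>

lemma sets_haar2: "sets haar2 = sets borel"
  using normalized_haar2_haar2 by (simp add: normalized_haar2_def)

lemma space_haar2: "space haar2 = UNIV"
  using sets_eq_imp_space_eq[OF sets_haar2] by simp

lemma emeasure_haar2_qball: "emeasure haar2 (qball a l) = ennreal (2 powi (- l))"
  by (rule normalized_haar2_qball[OF normalized_haar2_haar2])

lemma sigma_finite_haar2: "sigma_finite_measure haar2"
proof
  let ?A = "range (\<lambda>r. qball (of_rat r) 0)"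
  have "x \<in> \<Union> ?A" for x
  proof -
    obtain r where "qball x 0 = qball (of_rat r) 0" by (rule qball_rat)
    then have "x \<in> qball (of_rat r) 0" using qball_center[of x 0] by simp
    then show ?thesis by blast
  qed
  then have "\<Union> ?A = space haar2" by (auto simp: space_haar2)
  moreover have "countable ?A" by simp
  moreover have "?A \<subseteq> sets haar2" by (auto simp: sets_haar2)
  moreover have "\<forall>a\<in>?A. emeasure haar2 a \<noteq> \<infinity>" by (auto simp: emeasure_haar2_qball)
  ultimately show "\<exists>A. countable A \<and> A \<subseteq> sets haar2 \<and> \<Union> A = space haar2 \<and> (\<forall>a\<in>A. emeasure haar2 a \<noteq> \<infinity>)"
    by blast
qed

interpretation haar2: sigma_finite_measure haar2
  by (rule sigma_finite_haar2)

lemma sets_mu: "sets mu = sets borel"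
  unfolding mu_def using sets_pair_measure_cong[OF sets_lborel sets_haar2] by (simp only: borel_prod)

text \<open>Both sides are measures in \<open>B\<close>, so it suffices to compare them on balls.
  Absolute values are powers of 2, so the preimage of a ball is again a ball, with level raised by
  \<open>k\<close>.\<close>

lemma emeasure_haar2_affine:
  assumes c: "c \<noteq> 0" and B: "B \<in> sets borel"
  shows "emeasure haar2 B = ennreal (q2_abs c) * emeasure haar2 {y. w + c * y \<in> B}"
proof -
  let ?g = "\<lambda>y. w + c * y"
  have "continuous_on UNIV ?g"
    unfolding continuous_on_def by (intro ballI tendsto_add tendsto_const tendsto_mult_left_q2 tendsto_ident_at)
  then have g: "?g \<in> borel_measurable haar2"
    unfolding measurable_cong_sets[OF sets_haar2 refl] by (rule borel_measurable_continuous_onI)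
  have e: "emeasure (scale_measure (ennreal (q2_abs c)) (distr haar2 borel ?g)) B
      = ennreal (q2_abs c) * emeasure haar2 {y. ?g y \<in> B}" if "B \<in> sets borel" for B
    using that g by (simp add: emeasure_distr space_haar2 vimage_def)
  obtain k where k: "q2_abs c = 2 powi k" using q2_abs_powi[OF c] by blast
  have "haar2 = scale_measure (ennreal (q2_abs c)) (distr haar2 borel ?g)"
  proof (rule measure_eq_qballI)
    fix a l
    have "?g y \<in> qball a (int l) \<longleftrightarrow> y \<in> qball ((a - w) / c) (int l + k)" for y
    proof -
      have "?g y - a = c * (y - (a - w) / c)" using c by (simp add: field_simps)
      then have "q2_abs (?g y - a) = 2 powi k * q2_abs (y - (a - w) / c)" by (simp only: q2_abs_mult k)
      moreover have "(2::real) powi (- (int l + k)) = 2 powi (- int l) / 2 powi k"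
        using power_int_diff[of "2::real" "- int l" k] by simp
      ultimately show ?thesis by (simp add: qball_def pos_le_divide_eq mult.commute)
    qed
    then have "{y. ?g y \<in> qball a (int l)} = qball ((a - w) / c) (int l + k)" by blast
    moreover have "(2::real) powi k * 2 powi (- (int l + k)) = 2 powi (- int l)"
      using power_int_add[of "2::real" k "- (int l + k)"] by simp
    then have "ennreal (2 powi k) * ennreal (2 powi (- (int l + k))) = ennreal (2 powi (- int l))"
      by (subst ennreal_mult[symmetric]) simp_all
    ultimately show "emeasure haar2 (qball a (int l)) =
        emeasure (scale_measure (ennreal (q2_abs c)) (distr haar2 borel ?g)) (qball a (int l))"
      unfolding e[OF qball_borel] by (simp only: k emeasure_haar2_qball)
  qed (simp_all add: sets_haar2 emeasure_haar2_qball)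
  then show ?thesis using e[OF B] by simp
qed

lemma borel_kaffine_vimage: "A \<in> sets borel \<Longrightarrow> {x. kscale a x + v \<in> A} \<in> sets borel"
  using measurable_sets_borel[OF borel_measurable_continuous_onI[OF continuous_on_kaffine[of UNIV a v]]]
  by (simp add: vimage_def)

text \<open>Fubini: Haar scaling on each 2-adic slice gives \<open>abs2 a\<close>, and the real
  change of variables gives the ordinary absolute value.\<close>

lemma emeasure_mu_affine:
  assumes a: "a \<noteq> 0" and A: "A \<in> sets borel"
  shows "emeasure mu A = ennreal (\<bar>of_rat a\<bar> * abs2 a) * emeasure mu {x. kscale a x + v \<in> A}"
proof -
  let ?B = "{x. kscale a x + v \<in> A}"
  have A': "A \<in> sets (lborel \<Otimes>\<^sub>M haar2)" and B: "?B \<in> sets (lborel \<Otimes>\<^sub>M haar2)"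
    using A borel_kaffine_vimage[OF A] unfolding mu_def[symmetric] sets_mu by auto
  have slice: "emeasure haar2 (Pair (fst v + of_rat a * x) -` A) = ennreal (abs2 a) * emeasure haar2 (Pair x -` ?B)" for x
  proof -
    have "Pair (fst v + of_rat a * x) -` A \<in> sets borel"
      using sets_Pair1[OF A'] by (simp add: sets_haar2)
    from emeasure_haar2_affine[OF _ this, of "of_rat a" "snd v"] a
    show ?thesis by (simp add: kscale_def plus_prod_def add.commute vimage_def)
  qed
  have "emeasure mu A = (\<integral>\<^sup>+x. emeasure haar2 (Pair x -` A) \<partial>lborel)"
    unfolding mu_def by (rule haar2.emeasure_pair_measure_alt[OF A'])
  also have "\<dots> = ennreal \<bar>of_rat a\<bar> * (\<integral>\<^sup>+x. emeasure haar2 (Pair (fst v + of_rat a * x) -` A) \<partial>lborel)"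
    using a haar2.measurable_emeasure_Pair[OF A'] by (intro nn_integral_real_affine) auto
  also have "\<dots> = ennreal \<bar>of_rat a\<bar> * (ennreal (abs2 a) * (\<integral>\<^sup>+x. emeasure haar2 (Pair x -` ?B) \<partial>lborel))"
    unfolding slice by (subst nn_integral_cmult) (use haar2.measurable_emeasure_Pair[OF B] in auto)
  also have "(\<integral>\<^sup>+x. emeasure haar2 (Pair x -` ?B) \<partial>lborel) = emeasure mu ?B"
    unfolding mu_def by (rule haar2.emeasure_pair_measure_alt[OF B, symmetric])
  finally show ?thesis by (simp add: ennreal_mult mult.assoc)
qed

lemma null_sets_kaffine_vimage:
  assumes "a \<noteq> 0" "N \<in> null_sets mu" shows "{x. kscale a x + v \<in> N} \<in> null_sets mu"
proof -
  have N: "N \<in> sets borel" "emeasure mu N = 0" using assms(2) by (auto simp: null_sets_def sets_mu)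
  have "\<bar>of_rat a\<bar> * abs2 a > 0"
    using assms(1) abs2_nonneg[of a] by (intro mult_pos_pos) (simp_all add: less_le)
  then have "emeasure mu {x. kscale a x + v \<in> N} = 0"
    using emeasure_mu_affine[OF assms(1) N(1), of v] N(2) by (simp add: ennreal_eq_0_iff)
  then show ?thesis using borel_kaffine_vimage[OF N(1)] by (simp add: null_sets_def sets_mu)
qed

lemma translate_tile_borel: "translate v tile \<in> sets borel"
  by (rule borel_closed[OF closed_translate_tile])

lemma emeasure_translate_tile: "emeasure mu (translate v tile) = emeasure mu tile"
proof -
  have "translate v tile = {x. kscale 1 x + - v \<in> tile}" by (auto simp: in_translate_iff)
  then show ?thesis using emeasure_mu_affine[of 1 tile "- v"] borel_closed[OF closed_tile] by simp
qed

lemma translate_tile_fmeasurable: "translate v tile \<in> fmeasurable mu"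
proof -
  have "emeasure mu tile \<le> emeasure mu tile_box"
    using closed_tile_box by (intro emeasure_mono tile_subset_tile_box) (simp add: sets_mu borel_closed)
  also have "\<dots> = emeasure lborel {-2..2::real} * emeasure haar2 (qball 0 0)"
    unfolding mu_def tile_box_def by (rule haar2.emeasure_pair_measure_Times) (simp_all add: sets_haar2)
  also have "\<dots> < \<infinity>" by (simp add: emeasure_haar2_qball ennreal_mult_less_top)
  finally show ?thesis using translate_tile_borel
    by (intro fmeasurableI) (simp_all add: sets_mu emeasure_translate_tile)
qed

lemma measure_translate_tile: "measure mu (translate v tile) = measure mu tile"
  by (simp add: measure_def emeasure_translate_tile)

section \<open>The three pieces of the expanded tile\<close>

text \<open>The preimage under \<open>-2/3\<close> is the tile multiplied by \<open>-3/2\<close>;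
  \<open>+ 0\<close> fits the form of \<open>emeasure_mu_affine\<close>.\<close>

lemma tile_subdivision:
  "{x. kscale (- (2 / 3)) x + 0 \<in> tile} = translate (phi 0) tile \<union> translate (phi (1 / 2)) tile \<union> translate (phi 1) tile"
proof (rule set_eqI)
  fix x
  have "kscale (- (2 / 3)) x \<in> tile \<longleftrightarrow> (\<exists>d\<in>{0, 1, 2}. x - phi (d / 2) \<in> tile)"
    (is "?y \<in> tile \<longleftrightarrow> ?ex")
  proof
    show ?ex if "?y \<in> tile" using tile_step[OF that] by (simp add: kscale_kscale)
    show "?y \<in> tile" if ?ex
    proof -
      from that obtain d where "d \<in> {0, 1, 2}" "x - phi (d / 2) \<in> tile" by blast
      then show ?thesis using tile_unstep[of ?y d] by (simp add: kscale_kscale)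
    qed
  qed
  then show "x \<in> {x. kscale (- (2 / 3)) x + 0 \<in> tile} \<longleftrightarrow>
      x \<in> translate (phi 0) tile \<union> translate (phi (1 / 2)) tile \<union> translate (phi 1) tile"
    by (simp add: in_translate_iff)
qed

text \<open>Inclusion-exclusion for \<open>A\<close> and \<open>B\<close> with subadditivity for
  \<open>C\<close>: an overlap of positive measure would make the union too small.\<close>

lemma null_Int_of_measure_Un3:
  assumes "A \<in> fmeasurable M" "B \<in> fmeasurable M" "C \<in> fmeasurable M"
    and "measure M A + measure M B + measure M C \<le> measure M (A \<union> B \<union> C)"
  shows "A \<inter> B \<in> null_sets M"
proof -
  have AB: "A \<inter> B \<in> fmeasurable M" using assms by (intro fmeasurable.Int)
  have "measure M (A \<union> B \<union> C) \<le> measure M (A \<union> B) + measure M C"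
    using assms by (intro measure_Un_le) auto
  moreover have "measure M (A \<union> B) = measure M A + measure M B - measure M (A \<inter> B)"
    using assms by (intro measure_Un3)
  ultimately have "measure M (A \<inter> B) = 0"
    using assms(4) measure_nonneg[of M "A \<inter> B"] by linarith
  then show ?thesis using emeasure_eq_measure2[OF AB] fmeasurableD[OF AB] by (intro null_setsI) simp_all
qed

lemma null_digit_overlap:
  assumes "d \<in> {0, 1, 2}" "e \<in> {0, 1, 2}" "d \<noteq> e"
  shows "translate (phi (d / 2)) tile \<inter> translate (phi (e / 2)) tile \<in> null_sets mu"
proof -
  let ?T = "\<lambda>z. translate (phi z) tile"
  \<comment> \<open>The factor is \<open>2/3 * 1/2\<close>, for the real and the 2-adic size of
    \<open>-2/3\<close>.\<close>
  have "ennreal (1 / 3) * emeasure mu (?T 0 \<union> ?T (1 / 2) \<union> ?T 1) = emeasure mu tile"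
    using emeasure_mu_affine[of "- (2 / 3)" tile 0] borel_closed[OF closed_tile]
    unfolding tile_subdivision by (simp add: abs2_fractions of_rat_divide of_rat_minus)
  then have "1 / 3 * measure mu (?T 0 \<union> ?T (1 / 2) \<union> ?T 1) = measure mu tile"
    unfolding measure_def by (metis enn2real_ennreal enn2real_mult zero_le_divide_1_iff zero_le_numeral)
  then have U: "measure mu (?T 0 \<union> ?T (1 / 2) \<union> ?T 1) = 3 * measure mu tile" by simp
  \<comment> \<open>\<open>null_Int_of_measure_Un3\<close> speaks of the first two sets, so each
    pair is moved to the front.\<close>
  have perm: "?T 0 \<union> ?T 1 \<union> ?T (1 / 2) = ?T 0 \<union> ?T (1 / 2) \<union> ?T 1"
    "?T (1 / 2) \<union> ?T 1 \<union> ?T 0 = ?T 0 \<union> ?T (1 / 2) \<union> ?T 1" by auto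
  have "?T 0 \<inter> ?T (1 / 2) \<in> null_sets mu"
    by (rule null_Int_of_measure_Un3[of _ _ _ "?T 1"]) (auto intro: translate_tile_fmeasurable simp: U measure_translate_tile simp del: phi_0)
  moreover have "?T 0 \<inter> ?T 1 \<in> null_sets mu"
    by (rule null_Int_of_measure_Un3[of _ _ _ "?T (1 / 2)"])
      (auto intro: translate_tile_fmeasurable simp: U perm measure_translate_tile simp del: phi_0)
  moreover have "?T (1 / 2) \<inter> ?T 1 \<in> null_sets mu"
    by (rule null_Int_of_measure_Un3[of _ _ _ "?T 0"])
      (auto intro: translate_tile_fmeasurable simp: U perm measure_translate_tile simp del: phi_0)
  ultimately show ?thesis using assms by (auto simp: Int_commute)
qed

section \<open>Finite expansions and arbitrary pairs of translates\<close>

text \<open>Horner form of the sums of \<open>(-3/2)^i * d_i / 2\<close> over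
  \<open>i < k\<close>.\<close>

primrec expansions :: "nat \<Rightarrow> rat set" where
  "expansions 0 = {0}"
| "expansions (Suc k) = {d / 2 + - (3 / 2) * w | d w. d \<in> {0, 1, 2} \<and> w \<in> expansions k}"

text \<open>Padding with leading zeros brings two expansions to a common length.\<close>

lemma expansions_mono:
  assumes "k \<le> m" shows "expansions k \<subseteq> expansions m"
proof -
  have "expansions n \<subseteq> expansions (Suc n)" for n
  proof (induct n)
    case 0
    show ?case by simp
  next
    case (Suc n)
    have "z \<in> expansions (Suc (Suc n))" if z: "z \<in> expansions (Suc n)" for z
    proof -
      obtain d w where "z = d / 2 + - (3 / 2) * w" "d \<in> {0, 1, 2}" "w \<in> expansions n"
        using z unfolding expansions.simps(2) by blast
      then show ?thesis
        using subsetD[OF Suc] unfolding expansions.simps(2)[of "Suc n"] by (intro CollectI exI conjI) auto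
    qed
    then show ?case by (rule subsetI)
  qed
  then show ?thesis by (rule lift_Suc_mono_le[OF _ assms])
qed

lemma expansions_step:
  assumes "w \<in> (\<Union>k. expansions k)" "d \<in> {0, 1, 2}"
  shows "d / 2 + - (3 / 2) * w \<in> (\<Union>k. expansions k)"
proof -
  obtain k where "w \<in> expansions k" using assms(1) by blast
  then have "d / 2 + - (3 / 2) * w \<in> expansions (Suc k)" using assms(2) by auto
  then show ?thesis by blast
qed

text \<open>Removing a digit from \<open>a\<close> leaves \<open>b\<close> with
  \<open>3 * b = d - 2 * a\<close>, which is smaller in absolute value once that of \<open>a\<close>
  exceeds 2. The remaining integers form the chain 0, 1, -1, 2, -2, each obtained from its
  predecessor by one digit.\<close>

lemma int_expansion: "of_int a \<in> (\<Union>k. expansions k)"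
proof (induct "nat \<bar>a\<bar>" arbitrary: a rule: less_induct)
  case less
  let ?E = "\<Union>k. expansions k"
  have "0 \<in> expansions 0" by simp
  then have e0: "0 \<in> ?E" by blast
  have e1: "1 \<in> ?E" using expansions_step[OF e0, of 2] by simp
  have e2: "-1 \<in> ?E" using expansions_step[OF e1, of 1] by simp
  have e3: "2 \<in> ?E" using expansions_step[OF e2, of 1] by simp
  have e4: "-2 \<in> ?E" using expansions_step[OF e3, of 2] by simp
  show ?case
  proof (cases "\<bar>a\<bar> \<le> 2")
    case True
    then have "a \<in> {-2, -1, 0, 1, 2}" by auto
    then show ?thesis using e0 e1 e2 e3 e4 by (auto simp del: UN_iff)
  next
    case False
    obtain d b where d: "d \<in> {0, 1, 2}" and b: "of_int (2 * a) / 2 ^ Suc 0 = (d / 2 + - (3 / 2) * (of_int b / 2 ^ 0) :: rat)"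
      using dyadic_digit[of "2 * a" 0] by blast
    then have eq: "of_int a = d / 2 + - (3 / 2) * (of_int b :: rat)" by simp
    then have "3 * of_int b = d - 2 * (of_int a :: rat)" by simp
    then have "of_int (3 * b) \<in> {of_int (- 2 * a), of_int (1 - 2 * a), of_int (2 - 2 * a) :: rat}" using d by auto
    then have "3 * b \<in> {- 2 * a, 1 - 2 * a, 2 - 2 * a}" by (simp only: insert_iff empty_iff of_int_eq_iff)
    then have "nat \<bar>b\<bar> < nat \<bar>a\<bar>" using False by auto
    then have "of_int b \<in> ?E" by (rule less)
    then show ?thesis unfolding eq using d by (rule expansions_step)
  qed
qed

text \<open>Each digit removes one factor 2 from the denominator, until an integer is left.\<close>

lemma dyadic_expansion: "dyadic \<subseteq> (\<Union>k. expansions k)"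
proof -
  have "of_int a / 2 ^ l \<in> (\<Union>k. expansions k)" for a l
  proof (induct l arbitrary: a)
    case 0
    then show ?case using int_expansion[of a] by simp
  next
    case (Suc l)
    obtain d b where d: "d \<in> {0, 1, 2}" and eq: "of_int a / 2 ^ Suc l = (d / 2 + - (3 / 2) * (of_int b / 2 ^ l) :: rat)"
      using dyadic_digit[of a l] by blast
    show ?case unfolding eq using Suc d by (rule expansions_step)
  qed
  then show ?thesis by (auto simp: dyadic_def)
qed

lemma null_expansions_overlap:
  assumes "z \<in> expansions k" "w \<in> expansions k" "z \<noteq> w"
  shows "translate (phi z) tile \<inter> translate (phi w) tile \<in> null_sets mu"
  using assms
proof (induct k arbitrary: z w)
  case (Suc k)
  let ?T = "\<lambda>z. translate (phi z) tile"
  obtain d z' where z: "z = d / 2 + - (3 / 2) * z'" "d \<in> {0, 1, 2}" "z' \<in> expansions k" using Suc.prems(1) by auto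
  obtain e w' where w: "w = e / 2 + - (3 / 2) * w'" "e \<in> {0, 1, 2}" "w' \<in> expansions k" using Suc.prems(2) by auto
  show ?case
  proof (cases "z' = w'")
    \<comment> \<open>Equal tails force different lowest digits: the overlap is a translate of a
      digit overlap.\<close>
    case True
    then have "d \<noteq> e" using z(1) w(1) Suc.prems(3) by auto
    then have "{x. kscale 1 x + - phi (- (3 / 2) * w') \<in> ?T (d / 2) \<inter> ?T (e / 2)} \<in> null_sets mu"
      using z(2) w(2) by (intro null_sets_kaffine_vimage null_digit_overlap) simp_all
    also have "{x. kscale 1 x + - phi (- (3 / 2) * w') \<in> ?T (d / 2) \<inter> ?T (e / 2)} = ?T z \<inter> ?T w"
      unfolding z(1) w(1) True phi_add by (auto simp: in_translate_iff algebra_simps)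
    finally show ?thesis .
  next
    case False
    have N: "{x. kscale (- (2 / 3)) x + 0 \<in> ?T z' \<inter> ?T w'} \<in> null_sets mu"
      using Suc.hyps[OF z(3) w(3) False] by (intro null_sets_kaffine_vimage) simp_all
    \<comment> \<open>Each translate lies in the expanded translate of its tail, so the overlap lies
      in the expansion of a null set.\<close>
    have sub: "kscale (- (2 / 3)) x \<in> ?T v" if "x \<in> ?T (c / 2 + - (3 / 2) * v)" "c \<in> {0, 1, 2}" for x c v
    proof -
      have "kscale (- (3 / 2)) (kscale (- (2 / 3)) x - phi v) - phi (c / 2) = x - phi (c / 2 + - (3 / 2) * v)"
        unfolding phi_add by (simp add: kscale_diff kscale_kscale kscale_phi)
      then have "kscale (- (2 / 3)) x - phi v \<in> tile"
        using that tile_unstep[of "kscale (- (2 / 3)) x - phi v" c] by (simp only: in_translate_iff)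
      then show ?thesis by (simp only: in_translate_iff)
    qed
    have "?T z \<inter> ?T w \<subseteq> {x. kscale (- (2 / 3)) x + 0 \<in> ?T z' \<inter> ?T w'}"
      using sub[OF _ z(2), of _ z'] sub[OF _ w(2), of _ w'] unfolding z(1) w(1) by auto
    moreover have "?T z \<inter> ?T w \<in> sets mu"
      unfolding sets_mu by (intro sets.Int translate_tile_borel)
    ultimately show ?thesis by (rule null_sets_subset[OF N, rotated])
  qed
qed simp

lemma null_dyadic_overlap:
  assumes "z \<in> dyadic" "w \<in> dyadic" "z \<noteq> w"
  shows "translate (phi z) tile \<inter> translate (phi w) tile \<in> null_sets mu"
proof -
  obtain k m where "z \<in> expansions k" "w \<in> expansions m"
    using subsetD[OF dyadic_expansion assms(1)] subsetD[OF dyadic_expansion assms(2)] by (elim UN_E)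
  then have "z \<in> expansions (max k m)" "w \<in> expansions (max k m)"
    using expansions_mono[of k "max k m"] expansions_mono[of m "max k m"] by auto
  then show ?thesis using assms(3) by (rule null_expansions_overlap)
qed

theorem theorem6:
  "(\<Union>z\<in>dyadic. translate (phi z) tile) = UNIV \<and>
   (AE x in mu. \<exists>!T. T \<in> tiles \<and> x \<in> T)"
proof
  show "(\<Union>z\<in>dyadic. translate (phi z) tile) = UNIV" by (rule translates_cover)
  let ?T = "\<lambda>z. translate (phi z) tile"
  \<comment> \<open>There are countably many pairs, so almost every point avoids all the overlaps at
    once.\<close>
  have "AE x in mu. \<forall>z\<in>dyadic. \<forall>w\<in>dyadic. z \<noteq> w \<longrightarrow> x \<notin> ?T z \<inter> ?T w"
  proof (intro AE_ball_countable[THEN iffD2] ballI countableI_type)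
    fix z w assume "z \<in> dyadic" "w \<in> dyadic"
    then show "AE x in mu. z \<noteq> w \<longrightarrow> x \<notin> ?T z \<inter> ?T w"
      using AE_not_in[OF null_dyadic_overlap[of z w]] by (cases "z = w") auto
  qed
  then show "AE x in mu. \<exists>!T. T \<in> tiles \<and> x \<in> T"
  proof eventually_elim
    case (elim x)
    have "x \<in> (\<Union>z\<in>dyadic. ?T z)" unfolding translates_cover by (rule UNIV_I)
    then obtain z where z: "z \<in> dyadic" "x \<in> ?T z" by (rule UN_E)
    show ?case
    proof (rule ex1I[of _ "?T z"])
      show "?T z \<in> tiles \<and> x \<in> ?T z" using z by (auto simp: tiles_def)
      fix A assume "A \<in> tiles \<and> x \<in> A"
      then obtain w where w: "w \<in> dyadic" "A = ?T w" "x \<in> ?T w" by (auto simp: tiles_def)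
      then have "z = w" using elim z by blast
      then show "A = ?T z" using w(2) by simp
    qed
  qed
qed

end
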